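(* Let $\varphi$ be a surjective symbol for $S(\mathbb{R})$ such that $C_{\varphi}:S(\mathbb{R})\to S(\mathbb{R})$, $f\mapsto f\circ\varphi$, has closed range. Assume that there exists $k$ such that $\varphi'(x)\neq 0$ if $|x|>k$. Then $\varphi\in O_M$ and there exist $c>0$, $T> 0$ such that $|\varphi'(x)| \geq c(1+x^2)^{-T}$ for $|x|$ large enough.
   Context: All functions are real-valued. $S(\mathbb{R})$ is the (real) Schwartz space of smooth functions $f:\mathbb{R}\to\mathbb{R}$ such that $\pi_n(f):=\sup_{x\in \mathbb{R}}\sup_{0\leq j\leq n}(1+|x|^2)^n|f^{(j)}(x)|<\infty$ for each $n\in\mathbb{N}$, endowed with the Fréchet topology generated by $(\pi_n)_{n}$. A function $\varphi\in C^\infty(\mathbb{R})$ is called a symbol for $S(\mathbb{R})$ if $f\circ\varphi\in S(\mathbb{R})$ whenever $f\in S(\mathbb{R})$. $O_M$ is the space of multipliers of $S(\mathbb{R})$, i.e. the smooth functions $F:\mathbb{R}\to\mathbb{R}$ with $F\cdot S(\mathbb{R})\subset S(\mathbb{R})$; equivalently, for each $k\in\mathbb{N}_0$ there exist $C>0$ and $j\in\mathbb{N}$ such that $|F^{(k)}(x)|\leq C(1+x^2)^j$ for all $x\in\mathbb{R}$. An operator has closed range if its image is a closed subset of the target space. *)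

theory Defs
  imports "HOL-Analysis.Analysis"
begin

text \<open>
  The \<open>j\<close>-th derivative of \<open>f\<close> is \<open>(deriv ^^ j) f\<close>. Since \<open>deriv\<close> is total, smoothness has to
  require differentiability at every stage.
\<close>

definition smooth :: "(real \<Rightarrow> real) \<Rightarrow> bool" where
  "smooth f \<longleftrightarrow> (\<forall>j x. (deriv ^^ j) f field_differentiable at x)"

text \<open>Extended-real valued, so that the supremum is meaningful for every function.\<close>

definition schwartz_seminorm :: "nat \<Rightarrow> (real \<Rightarrow> real) \<Rightarrow> ereal" where
  "schwartz_seminorm n f =
     (SUP x. SUP j\<in>{0..n}. ereal ((1 + \<bar>x\<bar>^2) ^ n * \<bar>(deriv ^^ j) f x\<bar>))"

definition schwartz :: "(real \<Rightarrow> real) set" where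
  "schwartz = {f. smooth f \<and> (\<forall>n. schwartz_seminorm n f < \<infinity>)}"

definition schwartz_ball :: "nat \<Rightarrow> (real \<Rightarrow> real) \<Rightarrow> real \<Rightarrow> (real \<Rightarrow> real) set" where
  "schwartz_ball n f e = {g \<in> schwartz. schwartz_seminorm n (\<lambda>x. g x - f x) < ereal e}"

definition schwartz_topology :: "(real \<Rightarrow> real) topology" where
  "schwartz_topology =
     topology_generated_by {schwartz_ball n f e | n f e. f \<in> schwartz \<and> 0 < e}"

lemma topspace_schwartz_topology: "topspace schwartz_topology = schwartz"
proof -
  have z: "(deriv ^^ j) (\<lambda>x. 0 :: real) = (\<lambda>x. 0)" for j
    by (induction j) auto
  have "schwartz_seminorm 0 (\<lambda>x. f x - f x) = 0" for f :: "real \<Rightarrow> real"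
    unfolding schwartz_seminorm_def diff_self z by (simp flip: zero_ereal_def)
  then have "f \<in> schwartz_ball 0 f 1" if "f \<in> schwartz" for f
    using that unfolding schwartz_ball_def by simp
  moreover have "schwartz_ball n f e \<subseteq> schwartz" for n f e
    unfolding schwartz_ball_def by blast
  ultimately have "\<Union>{schwartz_ball n f e | n f e. f \<in> schwartz \<and> 0 < e} = schwartz"
    using zero_less_one by blast
  then show ?thesis
    unfolding schwartz_topology_def topology_generated_by_topspace .
qed

definition schwartz_symbol :: "(real \<Rightarrow> real) \<Rightarrow> bool" where
  "schwartz_symbol \<phi> \<longleftrightarrow> smooth \<phi> \<and> (\<forall>f\<in>schwartz. f \<circ> \<phi> \<in> schwartz)"

definition comp_op :: "(real \<Rightarrow> real) \<Rightarrow> (real \<Rightarrow> real) \<Rightarrow> real \<Rightarrow> real" where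
  "comp_op \<phi> f = f \<circ> \<phi>"

definition schwartz_closed_range :: "((real \<Rightarrow> real) \<Rightarrow> real \<Rightarrow> real) \<Rightarrow> bool" where
  "schwartz_closed_range T \<longleftrightarrow> closedin schwartz_topology (T ` schwartz)"

definition O_M :: "(real \<Rightarrow> real) set" where
  "O_M = {F. smooth F \<and> (\<forall>f\<in>schwartz. (\<lambda>x. F x * f x) \<in> schwartz)}"

end

theory Submission
  imports Defs "HOL-Real_Asymp.Real_Asymp"
begin

text \<open>
  Surjectivity and \<open>\<phi>' \<noteq> 0\<close> near infinity make \<open>\<phi>\<close> a diffeomorphism near infinity whose values there
  are taken nowhere else, so every bump centred far out is \<open>f \<circ> \<phi>\<close> for some Schwartz function \<open>f\<close>.
  As the range is closed, the same holds for rapidly decreasing infinite sums of such bumps with sparse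
  centres. If \<open>\<phi>\<close> or \<open>1 / \<phi>'\<close> outgrew every polynomial along some sequence, bumps placed along it
  would force \<open>f\<close> or \<open>f'\<close> to violate its Schwartz bounds; this gliding hump replaces the open mapping
  theorem. Once \<open>\<phi>\<close> has polynomial growth, a gliding hump in the target variable, composed with
  \<open>\<phi>\<close>, bounds the higher derivatives of \<open>\<phi>\<close>.
\<close>

section \<open>Smooth functions\<close>

text \<open>Closedness of the range supplies some f for each admissible series, but no estimate for
  f in terms of f \<circ> \<phi>. Hence the contradiction must come from one f and fixed Schwartz
  bounds of low order. The bump equals 1 + x near its centre, so its value and its slope there are
  both 1: one series tests \<phi> through f and 1 / \<phi>' through f' simultaneously. The m-th
  coefficient is the inverse m-th power of the weight 1 + x^2 at the m-th chosen point. Such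
  coefficients absorb every fixed power of the weight, so the series converges in all seminorms, but
  they do not absorb growth whose order increases with m. Growth of \<phi> has to be settled before
  its higher derivatives: the second series has centres \<phi>(x_m), and their weights must be
  controlled by those at x_m for the same coefficients to work.\<close>

definition ndiff_on :: "nat \<Rightarrow> real set \<Rightarrow> (real \<Rightarrow> real) \<Rightarrow> bool" where
  "ndiff_on k S f \<longleftrightarrow> (\<forall>j<k. \<forall>x\<in>S. (deriv ^^ j) f field_differentiable at x)"

lemma smooth_iff_ndiff_on: "smooth f \<longleftrightarrow> (\<forall>k. ndiff_on k UNIV f)"
  unfolding smooth_def ndiff_on_def by auto

lemma ndiff_on_0 [simp]: "ndiff_on 0 S f"
  by (simp add: ndiff_on_def)

text \<open>Peeling off the innermost derivative turns the calculus rules below into inductions on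
  \<open>k\<close> with the functions left arbitrary: only first derivatives are ever
  computed.\<close>

lemma ndiff_on_Suc_iff:
  "ndiff_on (Suc k) S f \<longleftrightarrow> (\<forall>x\<in>S. f field_differentiable at x) \<and> ndiff_on k S (deriv f)"
proof -
  have "(deriv ^^ Suc j) f = (deriv ^^ j) (deriv f)" for j
    by (metis comp_apply funpow_Suc_right)
  then show ?thesis
    unfolding ndiff_on_def All_less_Suc2 by (metis funpow_0)
qed

lemma ndiff_on_less: "ndiff_on k S f \<Longrightarrow> j \<le> k \<Longrightarrow> ndiff_on j S f"
  unfolding ndiff_on_def by auto

lemma ndiff_on_mono: "ndiff_on k S f \<Longrightarrow> T \<subseteq> S \<Longrightarrow> ndiff_on k T f"
  unfolding ndiff_on_def by auto

lemma ndiff_on_Un: "ndiff_on k S f \<Longrightarrow> ndiff_on k T f \<Longrightarrow> ndiff_on k (S \<union> T) f"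
  unfolding ndiff_on_def by auto

lemma higher_deriv_cong_open:
  assumes "open S" "\<And>x. x \<in> S \<Longrightarrow> f x = g x" "x \<in> S"
  shows "(deriv ^^ j) f x = (deriv ^^ j) g x"
  using assms by (intro higher_deriv_cong_ev) (auto simp: eventually_nhds)

lemma ndiff_on_cong:
  assumes S: "open S" and eq: "\<And>x. x \<in> S \<Longrightarrow> f x = g x" and f: "ndiff_on k S f"
  shows "ndiff_on k S g"
  unfolding ndiff_on_def
proof (intro allI impI ballI)
  fix j x assume j: "j < k" "x \<in> S"
  have ev: "\<forall>\<^sub>F y in nhds x. (deriv ^^ j) f y = (deriv ^^ j) g y"
    by (rule eventually_mono[OF eventually_nhds_in_open[OF S j(2)]])
      (rule higher_deriv_cong_open[OF S eq])
  obtain D where "((deriv ^^ j) f has_field_derivative D) (at x)"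
    using f j unfolding ndiff_on_def field_differentiable_def by blast
  then have "((deriv ^^ j) g has_field_derivative D) (at x)"
    using DERIV_cong_ev[OF refl ev refl] by simp
  then show "(deriv ^^ j) g field_differentiable at x"
    unfolding field_differentiable_def by blast
qed

text \<open>Openness lets \<open>f'\<close> replace \<open>deriv f\<close>: they agree on all of
  \<open>S\<close>, hence near each of its points, which is what derivatives of
  \<open>deriv f\<close> see.\<close>

lemma ndiff_on_SucI:
  assumes "open S" "\<And>x. x \<in> S \<Longrightarrow> (f has_field_derivative f' x) (at x)" "ndiff_on k S f'"
  shows "ndiff_on (Suc k) S f"
  unfolding ndiff_on_Suc_iff
proof
  show "\<forall>x\<in>S. f field_differentiable at x"
    using assms(2) unfolding field_differentiable_def by blast
  show "ndiff_on k S (deriv f)"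
    by (rule ndiff_on_cong[OF assms(1) _ assms(3)]) (metis DERIV_imp_deriv assms(2))
qed

lemma ndiff_on_SucD:
  assumes "ndiff_on (Suc k) S f" "x \<in> S"
  shows "(f has_field_derivative deriv f x) (at x)"
  using assms unfolding ndiff_on_Suc_iff by (simp add: DERIV_deriv_iff_field_differentiable)

lemma ndiff_on_const: "open S \<Longrightarrow> ndiff_on k S (\<lambda>x. c)"
proof (induction k arbitrary: c)
  case (Suc k)
  then show ?case
    by (intro ndiff_on_SucI[of _ _ "\<lambda>x. 0"]) (auto intro!: derivative_eq_intros)
qed simp

lemma ndiff_on_ident: "open S \<Longrightarrow> ndiff_on k S (\<lambda>x. x)"
proof (cases k)
  case (Suc l)
  assume "open S"
  then show ?thesis
    unfolding Suc by (intro ndiff_on_SucI[of _ _ "\<lambda>x. 1"] ndiff_on_const) (auto intro!: derivative_eq_intros)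
qed simp

lemma ndiff_on_add:
  assumes "open S"
  shows "ndiff_on k S f \<Longrightarrow> ndiff_on k S g \<Longrightarrow> ndiff_on k S (\<lambda>x. f x + g x)"
proof (induction k arbitrary: f g)
  case (Suc k)
  show ?case
  proof (rule ndiff_on_SucI[OF assms])
    show "((\<lambda>x. f x + g x) has_field_derivative deriv f x + deriv g x) (at x)" if "x \<in> S" for x
      using that Suc.prems by (intro DERIV_add ndiff_on_SucD)
    show "ndiff_on k S (\<lambda>x. deriv f x + deriv g x)"
      using Suc.prems by (intro Suc.IH) (auto simp: ndiff_on_Suc_iff)
  qed
qed simp

lemma ndiff_on_mult:
  assumes "open S"
  shows "ndiff_on k S f \<Longrightarrow> ndiff_on k S g \<Longrightarrow> ndiff_on k S (\<lambda>x. f x * g x)"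
proof (induction k arbitrary: f g)
  case (Suc k)
  have le: "ndiff_on k S f" "ndiff_on k S g"
    using Suc.prems ndiff_on_less[of "Suc k" S _ k] by auto
  show ?case
  proof (rule ndiff_on_SucI[OF assms])
    show "((\<lambda>x. f x * g x) has_field_derivative deriv f x * g x + deriv g x * f x) (at x)"
      if "x \<in> S" for x
      using that Suc.prems by (intro DERIV_mult ndiff_on_SucD)
    show "ndiff_on k S (\<lambda>x. deriv f x * g x + deriv g x * f x)"
      using Suc.prems le by (intro ndiff_on_add assms Suc.IH) (auto simp: ndiff_on_Suc_iff)
  qed
qed simp

lemma ndiff_on_inverse:
  assumes "open S" "\<And>x. x \<in> S \<Longrightarrow> f x \<noteq> 0"
  shows "ndiff_on k S f \<Longrightarrow> ndiff_on k S (\<lambda>x. inverse (f x))"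
proof (induction k)
  case (Suc k)
  have le: "ndiff_on k S f" "ndiff_on k S (deriv f)"
    using Suc.prems ndiff_on_less[of "Suc k" S _ k] by (auto simp: ndiff_on_Suc_iff)
  show ?case
  proof (rule ndiff_on_SucI[OF assms(1)])
    \<comment> \<open>The derivative is kept as a product containing \<open>inverse (f x)\<close>
      twice, so that the induction hypothesis and the product rule apply directly.\<close>
    show "((\<lambda>x. inverse (f x)) has_field_derivative (-1) * (inverse (f x) * (deriv f x * inverse (f x)))) (at x)"
      if "x \<in> S" for x
      using DERIV_inverse_fun[OF ndiff_on_SucD[OF Suc.prems that] assms(2)[OF that]]
      by (simp add: mult_ac)
    show "ndiff_on k S (\<lambda>x. (-1) * (inverse (f x) * (deriv f x * inverse (f x))))"
      using le by (intro ndiff_on_mult ndiff_on_const assms Suc.IH) auto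
  qed
qed simp

lemma ndiff_on_compose:
  assumes S: "open S" and T: "open T" and sub: "\<And>x. x \<in> S \<Longrightarrow> g x \<in> T"
  shows "ndiff_on k T f \<Longrightarrow> ndiff_on k S g \<Longrightarrow> ndiff_on k S (\<lambda>x. f (g x))"
proof (induction k arbitrary: f)
  case (Suc k)
  have le: "ndiff_on k S g" "ndiff_on k S (deriv g)" "ndiff_on k T (deriv f)"
    using Suc.prems ndiff_on_less[of "Suc k" S _ k] by (auto simp: ndiff_on_Suc_iff)
  show ?case
  proof (rule ndiff_on_SucI[OF S])
    show "((\<lambda>x. f (g x)) has_field_derivative deriv f (g x) * deriv g x) (at x)" if "x \<in> S" for x
      by (rule DERIV_chain2[OF ndiff_on_SucD[OF Suc.prems(1) sub[OF that]]
            ndiff_on_SucD[OF Suc.prems(2) that]])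
    show "ndiff_on k S (\<lambda>x. deriv f (g x) * deriv g x)"
      by (rule ndiff_on_mult[OF S Suc.IH[OF le(3,1)] le(2)])
  qed
qed simp

section \<open>Calculus of smooth functions on the whole line\<close>

lemma smooth_const [simp]: "smooth (\<lambda>x. c)"
  using ndiff_on_const[OF open_UNIV, of _ c] unfolding smooth_iff_ndiff_on by blast

lemma smooth_ident [simp]: "smooth (\<lambda>x. x)"
  using ndiff_on_ident[OF open_UNIV] unfolding smooth_iff_ndiff_on by blast

lemma smooth_add: "smooth f \<Longrightarrow> smooth g \<Longrightarrow> smooth (\<lambda>x. f x + g x)"
  using ndiff_on_add[OF open_UNIV, of _ f g] unfolding smooth_iff_ndiff_on by blast

lemma smooth_mult: "smooth f \<Longrightarrow> smooth g \<Longrightarrow> smooth (\<lambda>x. f x * g x)"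
  using ndiff_on_mult[OF open_UNIV, of _ f g] unfolding smooth_iff_ndiff_on by blast

lemma smooth_diff: "smooth f \<Longrightarrow> smooth g \<Longrightarrow> smooth (\<lambda>x. f x - g x)"
  using smooth_add[of f "\<lambda>x. (-1) * g x"] smooth_mult[of "\<lambda>x. -1" g] by simp

lemma smooth_inverse: "smooth f \<Longrightarrow> (\<And>x. f x \<noteq> 0) \<Longrightarrow> smooth (\<lambda>x. inverse (f x))"
  using ndiff_on_inverse[OF open_UNIV, of f] unfolding smooth_iff_ndiff_on by blast

lemma smooth_compose: "smooth f \<Longrightarrow> smooth g \<Longrightarrow> smooth (\<lambda>x. f (g x))"
  using ndiff_on_compose[OF open_UNIV open_UNIV UNIV_I, of _ f g]
  unfolding smooth_iff_ndiff_on by blast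

lemma smooth_deriv: "smooth f \<Longrightarrow> smooth (deriv f)"
  unfolding smooth_iff_ndiff_on using ndiff_on_Suc_iff by blast

lemma smooth_higher_deriv: "smooth f \<Longrightarrow> smooth ((deriv ^^ j) f)"
  by (induction j) (auto intro: smooth_deriv)

lemma smooth_has_deriv: "smooth f \<Longrightarrow> (f has_field_derivative deriv f x) (at x)"
  unfolding smooth_iff_ndiff_on by (metis UNIV_I ndiff_on_SucD)

lemma smooth_isCont: "smooth f \<Longrightarrow> isCont f x"
  using DERIV_isCont smooth_has_deriv by blast

text \<open>Smoothness is local, so a locally finite series may be compared near each point with a
  partial sum that depends on the point.\<close>

lemma smooth_locally:
  assumes "\<And>x. \<exists>S g. open S \<and> x \<in> S \<and> smooth g \<and> (\<forall>y\<in>S. f y = g y)"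
  shows "smooth f"
  unfolding smooth_iff_ndiff_on
proof
  fix k
  have "(deriv ^^ j) f field_differentiable at x" if "j < k" for j x
  proof -
    obtain S g where S: "open S" "x \<in> S" "smooth g" "\<forall>y\<in>S. f y = g y"
      using assms[of x] by blast
    have "ndiff_on k UNIV g"
      using S(3) smooth_iff_ndiff_on by blast
    then have "ndiff_on k S f"
      using ndiff_on_cong[OF S(1), of g f k] ndiff_on_mono[OF _ subset_UNIV, of k g S] S(4) by simp
    then show ?thesis
      using that S(2) unfolding ndiff_on_def by blast
  qed
  then show "ndiff_on k UNIV f"
    unfolding ndiff_on_def by blast
qed

section \<open>Linearity and translation of higher derivatives\<close>

lemma higher_deriv_add_smooth:
  assumes "smooth f" "smooth g"
  shows "(deriv ^^ j) (\<lambda>x. f x + g x) = (\<lambda>x. (deriv ^^ j) f x + (deriv ^^ j) g x)"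
proof (induction j)
  case (Suc j)
  have "deriv (\<lambda>x. (deriv ^^ j) f x + (deriv ^^ j) g x) x = deriv ((deriv ^^ j) f) x + deriv ((deriv ^^ j) g) x" for x
    by (intro DERIV_imp_deriv DERIV_add smooth_has_deriv smooth_higher_deriv assms)
  then show ?case
    by (simp add: Suc)
qed simp

lemma higher_deriv_cmult_smooth:
  assumes "smooth f"
  shows "(deriv ^^ j) (\<lambda>x. c * f x) = (\<lambda>x. c * (deriv ^^ j) f x)"
proof (induction j)
  case (Suc j)
  have "deriv (\<lambda>x. c * (deriv ^^ j) f x) x = c * deriv ((deriv ^^ j) f) x" for x
    by (intro DERIV_imp_deriv DERIV_cmult smooth_has_deriv smooth_higher_deriv assms)
  then show ?case
    by (simp add: Suc)
qed simp

lemma higher_deriv_diff_smooth: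
  assumes "smooth f" "smooth g"
  shows "(deriv ^^ j) (\<lambda>x. f x - g x) = (\<lambda>x. (deriv ^^ j) f x - (deriv ^^ j) g x)"
  using higher_deriv_add_smooth[of f "\<lambda>x. (-1) * g x" j] higher_deriv_cmult_smooth[of g j "-1"]
    smooth_mult[of "\<lambda>x. -1" g] assms by simp

lemma higher_deriv_shift:
  assumes "smooth f"
  shows "(deriv ^^ j) (\<lambda>x. f (x - s)) = (\<lambda>x. (deriv ^^ j) f (x - s))"
proof (induction j)
  case (Suc j)
  have "((\<lambda>x. x - s) has_field_derivative 1) (at x)" for x
    by (auto intro!: derivative_eq_intros)
  then have "((\<lambda>x. (deriv ^^ j) f (x - s)) has_field_derivative deriv ((deriv ^^ j) f) (x - s) * 1) (at x)" for x
    by (rule DERIV_chain2[OF smooth_has_deriv[OF smooth_higher_deriv[OF assms]]])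
  then show ?case
    using DERIV_imp_deriv by (fastforce simp: Suc)
qed simp

lemma smooth_sum: "(\<And>i. i \<in> I \<Longrightarrow> smooth (f i)) \<Longrightarrow> smooth (\<lambda>x. \<Sum>i\<in>I. f i x)"
  by (induction I rule: infinite_finite_induct) (auto intro: smooth_add)

lemma higher_deriv_const_real: "(deriv ^^ j) (\<lambda>x::real. c) = (\<lambda>x. if j = 0 then c else (0::real))"
  by (induction j) auto

lemma higher_deriv_sum_smooth:
  "(\<And>i. i \<in> I \<Longrightarrow> smooth (f i)) \<Longrightarrow>
    (deriv ^^ j) (\<lambda>x. \<Sum>i\<in>I. f i x) = (\<lambda>x. \<Sum>i\<in>I. (deriv ^^ j) (f i) x)"
  by (induction I rule: infinite_finite_induct)
    (auto simp: higher_deriv_add_smooth smooth_sum higher_deriv_const_real)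

section \<open>Cutoff functions\<close>

text \<open>The factor 1 / x^n makes the family stable under differentiation up to linear
  combinations; \<open>flat 0\<close> is the classical function exp(-1/x) extended by 0.\<close>

definition flat :: "nat \<Rightarrow> real \<Rightarrow> real" where
  "flat n x = (if x > 0 then exp (- (1 / x)) * (1 / x) ^ n else 0)"

lemma has_real_derivative_flat:
  "(flat n has_real_derivative flat (n + 2) x - real n * flat (n + 1) x) (at x)"
proof -
  consider "x > 0" | "x < 0" | "x = 0" by linarith
  then show ?thesis
  proof cases
    case 1
    have D: "((\<lambda>x. exp (- (1 / x)) * (1 / x) ^ n) has_real_derivative
        exp (- (1 / x)) * (1 / x ^ 2) * (1 / x) ^ n
          + exp (- (1 / x)) * (real n * (1 / x) ^ (n - 1) * (- (1 / x ^ 2)))) (at x)"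
      using 1 by (auto intro!: derivative_eq_intros simp: power2_eq_square)
    \<comment> \<open>The truncated exponent \<open>n - 1\<close> does no harm: for n = 0 the factor
      \<open>real n\<close> vanishes.\<close>
    have "real n * (1 / x) ^ (n - 1) * (1 / x ^ 2) = real n * (1 / x) ^ (n + 1)"
      using 1 by (cases n) (simp_all add: power2_eq_square)
    then have "exp (- (1 / x)) * (real n * (1 / x) ^ (n - 1) * (- (1 / x ^ 2)))
        = - (real n * flat (n + 1) x)"
      using 1 by (simp add: flat_def)
    moreover have "exp (- (1 / x)) * (1 / x ^ 2) * (1 / x) ^ n = flat (n + 2) x"
      using 1 by (simp add: flat_def power2_eq_square)
    ultimately have D': "((\<lambda>x. exp (- (1 / x)) * (1 / x) ^ n) has_real_derivative
        flat (n + 2) x - real n * flat (n + 1) x) (at x)"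
      using D by simp
    show ?thesis
      by (rule has_field_derivative_transform_within[OF D', of x]) (use 1 in \<open>auto simp: flat_def dist_real_def\<close>)
  next
    case 2
    have "((\<lambda>_. 0) has_real_derivative flat (n + 2) x - real n * flat (n + 1) x) (at x)"
      using 2 by (simp add: flat_def)
    then show ?thesis
      by (rule has_field_derivative_transform_within[of _ _ _ _ "- x"]) (use 2 in \<open>auto simp: flat_def dist_real_def\<close>)
  next
    case 3
    have "((\<lambda>h. flat (n + 1) h) \<longlongrightarrow> 0) (at 0)"
    proof (rule filterlim_split_at)
      have "((\<lambda>_. 0) \<longlongrightarrow> (0::real)) (at_left 0)" by simp
      then show "((\<lambda>h. flat (n + 1) h) \<longlongrightarrow> 0) (at_left 0)"
        by (rule Lim_transform_eventually)
          (auto simp: eventually_at_filter flat_def)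
      have "((\<lambda>h::real. exp (- (1 / h)) * (1 / h) ^ (n + 1)) \<longlongrightarrow> 0) (at_right 0)"
        by real_asymp
      then show "((\<lambda>h. flat (n + 1) h) \<longlongrightarrow> 0) (at_right 0)"
        by (rule Lim_transform_eventually)
          (auto simp: eventually_at_filter flat_def)
    qed
    \<comment> \<open>The difference quotient at 0 is again a member of the family, so
      differentiability at 0 is just its limit.\<close>
    moreover have "(flat n (0 + h) - flat n 0) / h = flat (n + 1) h" for h
      by (simp add: flat_def)
    ultimately have "(flat n has_real_derivative 0) (at 0)"
      by (simp add: DERIV_def)
    then show ?thesis
      using 3 by (simp add: flat_def)
  qed
qed

lemma smooth_flat: "smooth (flat n)"
proof -
  have "ndiff_on k UNIV (flat n)" for k
  proof (induction k arbitrary: n)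
    case (Suc k)
    have "ndiff_on k UNIV (\<lambda>x. flat (n + 2) x + (- real n) * flat (n + 1) x)"
      by (intro ndiff_on_add ndiff_on_mult ndiff_on_const Suc) auto
    then show ?case
      by (intro ndiff_on_SucI[of _ _ "\<lambda>x. flat (n + 2) x - real n * flat (n + 1) x"])
        (use has_real_derivative_flat in auto)
  qed simp
  then show ?thesis
    by (simp add: smooth_iff_ndiff_on)
qed

lemma smooth_cutoff_exists:
  obtains \<beta> :: "real \<Rightarrow> real" where "smooth \<beta>" "\<And>x. \<bar>x\<bar> \<le> 1/2 \<Longrightarrow> \<beta> x = 1" "\<And>x. \<bar>x\<bar> \<ge> 1 \<Longrightarrow> \<beta> x = 0"
proof -
  \<comment> \<open>A smooth step, 0 for t \<le> 0 and 1 for t \<ge> 1; the denominator is positive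
    because t or 1 - t is.\<close>
  define \<theta> where "\<theta> t = flat 0 t * inverse (flat 0 t + flat 0 (1 - t))" for t
  \<comment> \<open>The quadratic sends |x| \<le> 1/2 to t \<ge> 1 and |x| \<ge> 1 to t \<le>
    -2.\<close>
  define \<beta> where "\<beta> x = \<theta> (2 - 4 * (x * x))" for x :: real
  have flat_nonneg: "flat 0 t \<ge> 0" for t
    by (simp add: flat_def)
  have "flat 0 t + flat 0 (1 - t) > 0" for t
    using flat_nonneg[of t] flat_nonneg[of "1 - t"]
    by (cases "t > 0") (auto simp: flat_def add_pos_nonneg)
  then have "smooth \<theta>"
    unfolding \<theta>_def
    using smooth_compose[OF smooth_flat smooth_diff[OF smooth_const smooth_ident], of 0 1]
    by (intro smooth_mult smooth_inverse smooth_add smooth_flat) (auto simp: less_le)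
  then have "smooth \<beta>"
    unfolding \<beta>_def by (rule smooth_compose) (intro smooth_diff smooth_mult smooth_const smooth_ident)
  moreover have "\<beta> x = 1" if "\<bar>x\<bar> \<le> 1/2" for x
  proof -
    have "x * x \<le> 1/4"
      using abs_le_square_iff[of x "1/2"] that by (simp add: power2_eq_square)
    then show ?thesis
      by (auto simp: \<beta>_def \<theta>_def flat_def)
  qed
  moreover have "\<beta> x = 0" if "\<bar>x\<bar> \<ge> 1" for x
  proof -
    have "x * x \<ge> 1"
      using abs_le_square_iff[of 1 x] that by (simp add: power2_eq_square)
    then show ?thesis
      by (auto simp: \<beta>_def \<theta>_def flat_def)
  qed
  ultimately show ?thesis
    using that by blast
qed

section \<open>Schwartz functions\<close>

lemma schwartz_seminorm_le:
  assumes "\<And>x j. j \<le> n \<Longrightarrow> (1 + x\<^sup>2) ^ n * \<bar>(deriv ^^ j) f x\<bar> \<le> c"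
  shows "schwartz_seminorm n f \<le> ereal c"
  unfolding schwartz_seminorm_def by (intro SUP_least) (use assms in auto)

lemma le_schwartz_seminorm:
  assumes "j \<le> n"
  shows "ereal ((1 + x\<^sup>2) ^ n * \<bar>(deriv ^^ j) f x\<bar>) \<le> schwartz_seminorm n f"
  unfolding schwartz_seminorm_def
  by (rule SUP_upper2[OF UNIV_I, of _ _ x], rule SUP_upper2[of j]) (use assms in auto)

lemma schwartz_seminorm_nonneg: "schwartz_seminorm n f \<ge> 0"
proof -
  have "0 \<le> ereal ((1 + 0\<^sup>2) ^ n * \<bar>(deriv ^^ 0) f 0\<bar>)"
    by simp
  also have "\<dots> \<le> schwartz_seminorm n f"
    by (rule le_schwartz_seminorm) simp
  finally show ?thesis .
qed

lemma schwartz_seminorm_finite_iff: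
  "schwartz_seminorm n f < \<infinity> \<longleftrightarrow> (\<exists>c. \<forall>x. \<forall>j\<le>n. (1 + x\<^sup>2) ^ n * \<bar>(deriv ^^ j) f x\<bar> \<le> c)"
proof
  assume "schwartz_seminorm n f < \<infinity>"
  then obtain c where "schwartz_seminorm n f = ereal c"
    using schwartz_seminorm_nonneg[of n f] by (cases "schwartz_seminorm n f") auto
  then have "(1 + x\<^sup>2) ^ n * \<bar>(deriv ^^ j) f x\<bar> \<le> c" if "j \<le> n" for j x
    using le_schwartz_seminorm[OF that, of x f] by simp
  then show "\<exists>c. \<forall>x. \<forall>j\<le>n. (1 + x\<^sup>2) ^ n * \<bar>(deriv ^^ j) f x\<bar> \<le> c"
    by blast
next
  assume "\<exists>c. \<forall>x. \<forall>j\<le>n. (1 + x\<^sup>2) ^ n * \<bar>(deriv ^^ j) f x\<bar> \<le> c"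
  then obtain c where "\<And>x j. j \<le> n \<Longrightarrow> (1 + x\<^sup>2) ^ n * \<bar>(deriv ^^ j) f x\<bar> \<le> c"
    by blast
  then have "schwartz_seminorm n f \<le> ereal c"
    by (rule schwartz_seminorm_le)
  then show "schwartz_seminorm n f < \<infinity>"
    using less_ereal.simps(4) order.strict_trans1 by blast
qed

lemma schwartz_smooth: "f \<in> schwartz \<Longrightarrow> smooth f"
  by (simp add: schwartz_def)

text \<open>The seminorm of index \<open>max n j\<close> dominates, so the power of the weight and
  the order of the derivative can be chosen independently.\<close>

lemma schwartzD:
  assumes "f \<in> schwartz"
  obtains c where "c > 0" "\<And>x. (1 + x\<^sup>2) ^ n * \<bar>(deriv ^^ j) f x\<bar> \<le> c"
proof -
  define m where "m = max n j"
  have "schwartz_seminorm m f < \<infinity>"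
    using assms unfolding schwartz_def by blast
  then obtain c where c: "\<And>x i. i \<le> m \<Longrightarrow> (1 + x\<^sup>2) ^ m * \<bar>(deriv ^^ i) f x\<bar> \<le> c"
    unfolding schwartz_seminorm_finite_iff by blast
  have "(1 + x\<^sup>2) ^ n * \<bar>(deriv ^^ j) f x\<bar> \<le> max c 1" for x
  proof -
    have "(1 + x\<^sup>2) ^ n * \<bar>(deriv ^^ j) f x\<bar> \<le> (1 + x\<^sup>2) ^ m * \<bar>(deriv ^^ j) f x\<bar>"
      by (intro mult_right_mono power_increasing) (auto simp: m_def)
    also have "\<dots> \<le> c"
      by (rule c) (simp add: m_def)
    finally show ?thesis by simp
  qed
  then show ?thesis
    using that[of "max c 1"] by simp
qed

lemma schwartzI:
  assumes "smooth f" "\<And>n j. \<exists>c. \<forall>x. (1 + x\<^sup>2) ^ n * \<bar>(deriv ^^ j) f x\<bar> \<le> c"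
  shows "f \<in> schwartz"
proof -
  have "schwartz_seminorm n f < \<infinity>" for n
  proof -
    obtain c where c: "\<And>j x. (1 + x\<^sup>2) ^ n * \<bar>(deriv ^^ j) f x\<bar> \<le> c j"
      using assms(2)[of n] by metis
    have "(1 + x\<^sup>2) ^ n * \<bar>(deriv ^^ j) f x\<bar> \<le> Max (c ` {..n})" if "j \<le> n" for x j
      using that by (intro order.trans[OF c Max_ge]) auto
    then show ?thesis
      unfolding schwartz_seminorm_finite_iff by blast
  qed
  then show ?thesis
    using assms(1) by (simp add: schwartz_def)
qed

lemma schwartz_add:
  assumes "f \<in> schwartz" "g \<in> schwartz"
  shows "(\<lambda>x. f x + g x) \<in> schwartz"
proof (rule schwartzI)
  have sm: "smooth f" "smooth g"
    using assms schwartz_smooth by auto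
  then show "smooth (\<lambda>x. f x + g x)"
    by (rule smooth_add)
  fix n j
  obtain c where c: "\<And>x. (1 + x\<^sup>2) ^ n * \<bar>(deriv ^^ j) f x\<bar> \<le> c"
    using schwartzD[OF assms(1)] by metis
  obtain d where d: "\<And>x. (1 + x\<^sup>2) ^ n * \<bar>(deriv ^^ j) g x\<bar> \<le> d"
    using schwartzD[OF assms(2)] by metis
  have "(1 + x\<^sup>2) ^ n * \<bar>(deriv ^^ j) f x + (deriv ^^ j) g x\<bar> \<le> c + d" for x
  proof -
    have "(1 + x\<^sup>2) ^ n * \<bar>(deriv ^^ j) f x + (deriv ^^ j) g x\<bar>
        \<le> (1 + x\<^sup>2) ^ n * (\<bar>(deriv ^^ j) f x\<bar> + \<bar>(deriv ^^ j) g x\<bar>)"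
      by (intro mult_left_mono) auto
    also have "\<dots> \<le> c + d"
      using c[of x] d[of x] by (simp add: distrib_left)
    finally show ?thesis .
  qed
  then show "\<exists>c. \<forall>x. (1 + x\<^sup>2) ^ n * \<bar>(deriv ^^ j) (\<lambda>x. f x + g x) x\<bar> \<le> c"
    unfolding higher_deriv_add_smooth[OF sm] by blast
qed

lemma schwartz_cmult:
  assumes "f \<in> schwartz"
  shows "(\<lambda>x. a * f x) \<in> schwartz"
proof (rule schwartzI)
  have sm: "smooth f"
    using assms schwartz_smooth by auto
  then show "smooth (\<lambda>x. a * f x)"
    by (intro smooth_mult) auto
  fix n j
  obtain c where c: "\<And>x. (1 + x\<^sup>2) ^ n * \<bar>(deriv ^^ j) f x\<bar> \<le> c"
    using schwartzD[OF assms(1)] by metis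
  have "(1 + x\<^sup>2) ^ n * \<bar>a * (deriv ^^ j) f x\<bar> \<le> \<bar>a\<bar> * c" for x
    using mult_left_mono[OF c[of x], of "\<bar>a\<bar>"] by (simp add: abs_mult mult_ac)
  then show "\<exists>c. \<forall>x. (1 + x\<^sup>2) ^ n * \<bar>(deriv ^^ j) (\<lambda>x. a * f x) x\<bar> \<le> c"
    unfolding higher_deriv_cmult_smooth[OF sm] by blast
qed

lemma schwartz_zero: "(\<lambda>x. 0) \<in> schwartz"
  by (rule schwartzI) (auto simp: higher_deriv_const_real)

lemma schwartz_sum:
  "(\<And>i. i \<in> I \<Longrightarrow> f i \<in> schwartz) \<Longrightarrow> (\<lambda>x. \<Sum>i\<in>I. f i x) \<in> schwartz"
  by (induction I rule: infinite_finite_induct) (auto intro: schwartz_add simp: schwartz_zero)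

lemma schwartz_deriv:
  assumes "f \<in> schwartz"
  shows "deriv f \<in> schwartz"
proof (rule schwartzI)
  show "smooth (deriv f)"
    using assms by (intro smooth_deriv schwartz_smooth)
  show "\<exists>c. \<forall>x. (1 + x\<^sup>2) ^ n * \<bar>(deriv ^^ j) (deriv f) x\<bar> \<le> c" for n j
    using schwartzD[OF assms, of n "Suc j"] by (metis comp_apply funpow_Suc_right)
qed

lemma schwartz_compact_support:
  assumes sm: "smooth f" and R: "\<And>x. \<bar>x\<bar> > R \<Longrightarrow> f x = 0"
  shows "f \<in> schwartz"
proof (rule schwartzI[OF sm])
  fix n j
  let ?h = "\<lambda>x. (1 + x\<^sup>2) ^ n * (deriv ^^ j) f x"
  have "continuous_on {- \<bar>R\<bar>..\<bar>R\<bar>} ?h"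
    by (intro continuous_intros continuous_at_imp_continuous_on ballI
        smooth_isCont smooth_higher_deriv sm)
  then have "bounded (?h ` {- \<bar>R\<bar>..\<bar>R\<bar>})"
    by (intro compact_imp_bounded compact_continuous_image compact_Icc)
  then obtain c where c0: "c > 0" "\<forall>y\<in>?h ` {- \<bar>R\<bar>..\<bar>R\<bar>}. norm y \<le> c"
    unfolding bounded_pos by blast
  have c: "\<bar>?h x\<bar> \<le> c" if "\<bar>x\<bar> \<le> \<bar>R\<bar>" for x
  proof -
    have "?h x \<in> ?h ` {- \<bar>R\<bar>..\<bar>R\<bar>}"
      using that by (intro imageI) (simp add: abs_le_iff)
    then show ?thesis
      using c0(2) by fastforce
  qed
  have "(1 + x\<^sup>2) ^ n * \<bar>(deriv ^^ j) f x\<bar> \<le> c" for x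
  proof (cases "\<bar>x\<bar> \<le> \<bar>R\<bar>")
    case True
    then show ?thesis
      using c[OF True] by (simp add: abs_mult)
  next
    case False
    \<comment> \<open>The derivatives vanish off the support because f is zero on this open set;
      \<open>\<bar>R\<bar>\<close> is used since \<open>R\<close> may be negative.\<close>
    have "open {y::real. \<bar>y\<bar> > \<bar>R\<bar>}"
      by (intro open_Collect_less continuous_intros)
    then have "(deriv ^^ j) f x = (deriv ^^ j) (\<lambda>x. 0) x"
      using False R by (intro higher_deriv_cong_open[of "{y. \<bar>y\<bar> > \<bar>R\<bar>}"]) auto
    then show ?thesis
      using c0(1) by (simp add: higher_deriv_const_real)
  qed
  then show "\<exists>c. \<forall>x. (1 + x\<^sup>2) ^ n * \<bar>(deriv ^^ j) f x\<bar> \<le> c"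
    by blast
qed

section \<open>Neighbourhoods and closed sets in the seminorm topology\<close>

lemma schwartz_seminorm_add_le:
  assumes "smooth f" "smooth g" "smooth h"
  shows "schwartz_seminorm n (\<lambda>x. f x - h x)
    \<le> schwartz_seminorm n (\<lambda>x. f x - g x) + schwartz_seminorm n (\<lambda>x. g x - h x)"
  unfolding schwartz_seminorm_def[of n "\<lambda>x. f x - h x"]
proof (intro SUP_least)
  fix x j assume "j \<in> {0..n}"
  then have j: "j \<le> n" by simp
  have "ereal ((1 + \<bar>x\<bar>\<^sup>2) ^ n * \<bar>(deriv ^^ j) (\<lambda>x. f x - h x) x\<bar>)
      \<le> ereal ((1 + x\<^sup>2) ^ n * (\<bar>(deriv ^^ j) (\<lambda>x. f x - g x) x\<bar>
         + \<bar>(deriv ^^ j) (\<lambda>x. g x - h x) x\<bar>))"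
    unfolding higher_deriv_diff_smooth[OF assms(1,2)] higher_deriv_diff_smooth[OF assms(1,3)]
      higher_deriv_diff_smooth[OF assms(2,3)] ereal_less_eq power2_abs
    by (intro mult_left_mono) auto
  also have "\<dots> = ereal ((1 + x\<^sup>2) ^ n * \<bar>(deriv ^^ j) (\<lambda>x. f x - g x) x\<bar>)
      + ereal ((1 + x\<^sup>2) ^ n * \<bar>(deriv ^^ j) (\<lambda>x. g x - h x) x\<bar>)"
    by (simp add: distrib_left)
  also have "\<dots> \<le> schwartz_seminorm n (\<lambda>x. f x - g x) + schwartz_seminorm n (\<lambda>x. g x - h x)"
    by (intro add_mono le_schwartz_seminorm j)
  finally show "ereal ((1 + \<bar>x\<bar>\<^sup>2) ^ n * \<bar>(deriv ^^ j) (\<lambda>x. f x - h x) x\<bar>) \<le> \<dots>" .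
qed

lemma schwartz_seminorm_mono:
  assumes "m \<le> n"
  shows "schwartz_seminorm m f \<le> schwartz_seminorm n f"
  unfolding schwartz_seminorm_def[of m]
proof (intro SUP_least)
  fix x j assume "j \<in> {0..m}"
  then have "j \<le> n" using assms by simp
  have "ereal ((1 + \<bar>x\<bar>\<^sup>2) ^ m * \<bar>(deriv ^^ j) f x\<bar>) \<le> ereal ((1 + x\<^sup>2) ^ n * \<bar>(deriv ^^ j) f x\<bar>)"
    unfolding ereal_less_eq power2_abs using assms
    by (intro mult_right_mono power_increasing) auto
  also have "\<dots> \<le> schwartz_seminorm n f"
    by (rule le_schwartz_seminorm[OF \<open>j \<le> n\<close>])
  finally show "ereal ((1 + \<bar>x\<bar>\<^sup>2) ^ m * \<bar>(deriv ^^ j) f x\<bar>) \<le> schwartz_seminorm n f" .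
qed

text \<open>By definition the balls are merely a subbasis with arbitrary centres. The triangle
  inequality recentres them at \<open>g\<close>, and monotonicity of the seminorms in the index
  replaces two balls by one with the larger index and the smaller radius.\<close>

lemma openin_schwartz_topologyD:
  assumes "openin schwartz_topology U" "g \<in> U"
  obtains n e where "e > 0" "\<And>h. h \<in> schwartz \<Longrightarrow> schwartz_seminorm n (\<lambda>x. h x - g x) < ereal e \<Longrightarrow> h \<in> U"
proof -
  have "generate_topology_on {schwartz_ball n f e | n f e. f \<in> schwartz \<and> 0 < e} U"
    using assms(1) unfolding schwartz_topology_def by (rule openin_topology_generated_by)
  then have "g \<in> U \<Longrightarrow> \<exists>n e. e > 0 \<and> (\<forall>h\<in>schwartz. schwartz_seminorm n (\<lambda>x. h x - g x) < ereal e \<longrightarrow> h \<in> U)"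
  proof (induction rule: generate_topology_on.induct)
    case (Int a b)
    obtain m d where m: "d > 0"
      "\<forall>h\<in>schwartz. schwartz_seminorm m (\<lambda>x. h x - g x) < ereal d \<longrightarrow> h \<in> a"
      using Int.IH(1)[OF IntD1[OF Int.prems]] by blast
    obtain n e where n: "e > 0"
      "\<forall>h\<in>schwartz. schwartz_seminorm n (\<lambda>x. h x - g x) < ereal e \<longrightarrow> h \<in> b"
      using Int.IH(2)[OF IntD2[OF Int.prems]] by blast
    have "h \<in> a \<inter> b"
      if h: "h \<in> schwartz" "schwartz_seminorm (max m n) (\<lambda>x. h x - g x) < ereal (min d e)" for h
    proof -
      have "schwartz_seminorm i (\<lambda>x. h x - g x) < ereal (min d e)" if "i \<le> max m n" for i
        using schwartz_seminorm_mono[OF that] h(2) by (rule order.strict_trans1)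
      then have "schwartz_seminorm m (\<lambda>x. h x - g x) < ereal d" "schwartz_seminorm n (\<lambda>x. h x - g x) < ereal e"
        by (rule order.strict_trans2, simp, simp)+
      then show ?thesis
        using m(2) n(2) h(1) by blast
    qed
    moreover have "min d e > 0"
      using m(1) n(1) by simp
    ultimately show ?case by blast
  next
    case (Basis s)
    then obtain n f e where s: "s = schwartz_ball n f e" "f \<in> schwartz" "0 < e"
      by blast
    then have g: "g \<in> schwartz" and ge: "schwartz_seminorm n (\<lambda>x. g x - f x) < ereal e"
      using Basis.prems unfolding schwartz_ball_def by auto
    then obtain r where r: "schwartz_seminorm n (\<lambda>x. g x - f x) = ereal r" "r < e"
      using schwartz_seminorm_nonneg[of n "\<lambda>x. g x - f x"]
      by (cases "schwartz_seminorm n (\<lambda>x. g x - f x)") auto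
    have "h \<in> s" if h: "h \<in> schwartz" "schwartz_seminorm n (\<lambda>x. h x - g x) < ereal (e - r)" for h
    proof -
      have "schwartz_seminorm n (\<lambda>x. h x - f x) \<le> schwartz_seminorm n (\<lambda>x. h x - g x) + ereal r"
        unfolding r(1)[symmetric] using h(1) g s(2) by (intro schwartz_seminorm_add_le schwartz_smooth)
      also have "\<dots> < ereal e"
        using h(2) schwartz_seminorm_nonneg[of n "\<lambda>x. h x - g x"]
        by (cases "schwartz_seminorm n (\<lambda>x. h x - g x)") auto
      finally show ?thesis
        using h(1) unfolding s(1) schwartz_ball_def by simp
    qed
    moreover have "e - r > 0"
      using r(2) by simp
    ultimately show ?case by blast
  next
    case (UN K)
    obtain k where k: "k \<in> K" "g \<in> k"
      using UN.prems by blast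
    show ?case
      using UN.IH[OF k] k(1) by blast
  qed simp
  then show ?thesis
    using that assms(2) by blast
qed

text \<open>A single \<open>G M\<close> in each seminorm ball is enough: if \<open>g\<close> were in
  the open complement, so would be a whole ball around it, including a member of
  \<open>R\<close>.\<close>

lemma closedin_schwartz_topology_sequentially:
  assumes R: "closedin schwartz_topology R" and g: "g \<in> schwartz"
    and G: "\<And>M. G M \<in> R"
    and lim: "\<And>n e. e > 0 \<Longrightarrow> \<exists>M. schwartz_seminorm n (\<lambda>x. G M x - g x) < ereal e"
  shows "g \<in> R"
proof (rule ccontr)
  assume "g \<notin> R"
  have sub: "R \<subseteq> schwartz"
    using closedin_subset[OF R] by (simp add: topspace_schwartz_topology)
  have "openin schwartz_topology (schwartz - R)"
    using R by (simp add: closedin_def topspace_schwartz_topology)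
  then obtain n e where ne: "e > 0"
    "\<And>h. h \<in> schwartz \<Longrightarrow> schwartz_seminorm n (\<lambda>x. h x - g x) < ereal e \<Longrightarrow> h \<in> schwartz - R"
    using openin_schwartz_topologyD \<open>g \<notin> R\<close> g by (metis DiffI)
  obtain M where "schwartz_seminorm n (\<lambda>x. G M x - g x) < ereal e"
    using lim[OF ne(1)] by blast
  then show False
    using ne(2)[of "G M"] G[of M] sub by blast
qed

section \<open>Multiplication by functions with polynomially bounded derivatives\<close>

definition poly_bounded :: "(real \<Rightarrow> real) \<Rightarrow> bool" where
  "poly_bounded f \<longleftrightarrow> (\<exists>c p. \<forall>x. \<bar>f x\<bar> \<le> c * (1 + x\<^sup>2) ^ p)"

text \<open>One application of (F f)' = F' f + F f' lowers the order; the hypotheses pass from F to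
  F' and from f to f', so the induction over arbitrary f and F needs no Leibniz formula.\<close>

lemma mult_poly_bounded_schwartz:
  assumes "f \<in> schwartz" "smooth F" "\<And>j. poly_bounded ((deriv ^^ j) F)"
  shows "(\<lambda>x. F x * f x) \<in> schwartz"
proof (rule schwartzI)
  show "smooth (\<lambda>x. F x * f x)"
    by (rule smooth_mult[OF assms(2) schwartz_smooth[OF assms(1)]])
  show "\<exists>c. \<forall>x. (1 + x\<^sup>2) ^ n * \<bar>(deriv ^^ j) (\<lambda>x. F x * f x) x\<bar> \<le> c" for n j
    using assms
  proof (induction j arbitrary: f F)
    case 0
    obtain c p where cp: "\<And>x. \<bar>F x\<bar> \<le> c * (1 + x\<^sup>2) ^ p"
      using "0.prems"(3)[of 0] unfolding poly_bounded_def by auto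
    obtain d where d: "\<And>x. (1 + x\<^sup>2) ^ (n + p) * \<bar>f x\<bar> \<le> d"
      using schwartzD[OF "0.prems"(1), of "n + p" 0] by (metis funpow_0)
    have "(1 + x\<^sup>2) ^ n * \<bar>F x * f x\<bar> \<le> \<bar>c\<bar> * d" for x
    proof -
      have "\<bar>F x\<bar> \<le> \<bar>c\<bar> * (1 + x\<^sup>2) ^ p"
        by (rule order.trans[OF cp mult_right_mono]) auto
      then have "(1 + x\<^sup>2) ^ n * \<bar>F x * f x\<bar> \<le> (1 + x\<^sup>2) ^ n * (\<bar>c\<bar> * (1 + x\<^sup>2) ^ p * \<bar>f x\<bar>)"
        unfolding abs_mult by (intro mult_left_mono mult_right_mono) auto
      also have "\<dots> = \<bar>c\<bar> * ((1 + x\<^sup>2) ^ (n + p) * \<bar>f x\<bar>)"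
        by (simp add: power_add)
      also have "\<dots> \<le> \<bar>c\<bar> * d"
        by (intro mult_left_mono d) auto
      finally show ?thesis .
    qed
    then show ?case
      by auto
  next
    case (Suc j)
    have pb: "poly_bounded ((deriv ^^ j) (deriv F))" for j
      using Suc.prems(3)[of "Suc j"] by (simp add: funpow_swap1)
    have sm: "smooth f" "smooth (deriv f)" "smooth (deriv F)"
      using Suc.prems by (auto intro: schwartz_smooth smooth_deriv)
    obtain c where c: "\<And>x. (1 + x\<^sup>2) ^ n * \<bar>(deriv ^^ j) (\<lambda>x. deriv F x * f x) x\<bar> \<le> c"
      using Suc.IH[OF Suc.prems(1) sm(3) pb] by blast
    obtain d where d: "\<And>x. (1 + x\<^sup>2) ^ n * \<bar>(deriv ^^ j) (\<lambda>x. F x * deriv f x) x\<bar> \<le> d"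
      using Suc.IH[OF schwartz_deriv[OF Suc.prems(1)] Suc.prems(2,3)] by blast
    have "deriv (\<lambda>x. F x * f x) = (\<lambda>x. deriv F x * f x + F x * deriv f x)"
      by (rule ext, rule DERIV_imp_deriv)
        (use DERIV_mult[OF smooth_has_deriv[OF Suc.prems(2)] smooth_has_deriv[OF sm(1)]]
          in \<open>simp add: mult.commute\<close>)
    then have "(deriv ^^ Suc j) (\<lambda>x. F x * f x) =
        (deriv ^^ j) (\<lambda>x. deriv F x * f x + F x * deriv f x)"
      by (metis comp_apply funpow_Suc_right)
    also have "\<dots> = (\<lambda>x. (deriv ^^ j) (\<lambda>x. deriv F x * f x) x + (deriv ^^ j) (\<lambda>x. F x * deriv f x) x)"
      using sm Suc.prems(2) by (intro higher_deriv_add_smooth smooth_mult)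
    finally have eq: "(deriv ^^ Suc j) (\<lambda>x. F x * f x) = \<dots>" .
    have "(1 + x\<^sup>2) ^ n * \<bar>(deriv ^^ Suc j) (\<lambda>x. F x * f x) x\<bar> \<le> c + d" for x
    proof -
      have "(1 + x\<^sup>2) ^ n * \<bar>(deriv ^^ Suc j) (\<lambda>x. F x * f x) x\<bar>
        \<le> (1 + x\<^sup>2) ^ n * (\<bar>(deriv ^^ j) (\<lambda>x. deriv F x * f x) x\<bar> + \<bar>(deriv ^^ j) (\<lambda>x. F x * deriv f x) x\<bar>)"
        unfolding eq by (intro mult_left_mono abs_triangle_ineq) auto
      then show ?thesis
        using c[of x] d[of x] by (simp add: distrib_left)
    qed
    then show ?case by blast
  qed
qed

section \<open>Sparse series of bumps\<close>

text \<open>A cutoff times 1 + x: the constant term makes values visible at the centre, the linear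
  term makes derivatives visible.\<close>

lemma smooth_linear_bump_exists:
  obtains \<eta> :: "real \<Rightarrow> real" where "smooth \<eta>"
    "\<And>x. \<bar>x\<bar> \<le> 1/2 \<Longrightarrow> \<eta> x = 1 + x" "\<And>x. \<bar>x\<bar> \<ge> 1 \<Longrightarrow> \<eta> x = 0"
proof -
  obtain \<beta> :: "real \<Rightarrow> real" where \<beta>: "smooth \<beta>" "\<And>x. \<bar>x\<bar> \<le> 1/2 \<Longrightarrow> \<beta> x = 1"
    "\<And>x. \<bar>x\<bar> \<ge> 1 \<Longrightarrow> \<beta> x = 0"
    by (rule smooth_cutoff_exists) blast
  show ?thesis
  proof (rule that[of "\<lambda>x. (1 + x) * \<beta> x"])
    show "smooth (\<lambda>x. (1 + x) * \<beta> x)"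
      by (intro smooth_mult smooth_add smooth_const smooth_ident \<beta>(1))
  qed (use \<beta> in auto)
qed

text \<open>The difference of the two sides is a sum of squares. The point is that translating a
  Schwartz function by s enlarges its weighted bounds by no more than a power of 1 + s^2.\<close>

lemma peetre_inequality: "1 + (x::real)\<^sup>2 \<le> 2 * (1 + s\<^sup>2) * (1 + (x - s)\<^sup>2)"
proof -
  have "2 * (1 + s\<^sup>2) * (1 + (x - s)\<^sup>2) - (1 + x\<^sup>2) = 1 + (x - 2 * s)\<^sup>2 + 2 * (s * (x - s))\<^sup>2"
    by (simp add: power2_eq_square algebra_simps)
  moreover have "\<dots> \<ge> 0"
    by simp
  ultimately show ?thesis by linarith
qed

lemma schwartz_shift_bound:
  assumes "f \<in> schwartz"
  obtains c where "c > 0" "\<And>x s. (1 + x\<^sup>2) ^ n * \<bar>(deriv ^^ j) f (x - s)\<bar> \<le> c * (1 + s\<^sup>2) ^ n"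
proof -
  obtain c where c: "c > 0" "\<And>x. (1 + x\<^sup>2) ^ n * \<bar>(deriv ^^ j) f x\<bar> \<le> c"
    using schwartzD[OF assms] by metis
  have "(1 + x\<^sup>2) ^ n * \<bar>(deriv ^^ j) f (x - s)\<bar> \<le> 2 ^ n * c * (1 + s\<^sup>2) ^ n" for x s
  proof -
    have "(1 + x\<^sup>2) ^ n * \<bar>(deriv ^^ j) f (x - s)\<bar>
        \<le> (2 * (1 + s\<^sup>2) * (1 + (x - s)\<^sup>2)) ^ n * \<bar>(deriv ^^ j) f (x - s)\<bar>"
      by (intro mult_right_mono power_mono peetre_inequality) auto
    also have "\<dots> = 2 ^ n * (1 + s\<^sup>2) ^ n * ((1 + (x - s)\<^sup>2) ^ n * \<bar>(deriv ^^ j) f (x - s)\<bar>)"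
      by (simp only: power_mult_distrib mult.assoc)
    also have "\<dots> \<le> 2 ^ n * (1 + s\<^sup>2) ^ n * c"
      by (intro mult_left_mono c) auto
    finally show ?thesis by (simp add: mult_ac)
  qed
  then show ?thesis
    using that[of "2 ^ n * c"] c(1) by simp
qed

text \<open>Used twice: with centres in the source variable of the symbol, and with centres that are
  values of the symbol. The gap 2 is imposed on absolute values, which both separates the supports
  of radius 1 and drives the centres to infinity, whatever their signs.\<close>

locale bump_series =
  fixes \<eta> :: "real \<Rightarrow> real" and s a :: "nat \<Rightarrow> real"
  assumes smooth_bump: "smooth \<eta>"
    and bump_linear: "\<And>x. \<bar>x\<bar> \<le> 1/2 \<Longrightarrow> \<eta> x = 1 + x"
    and bump_support: "\<And>x. \<bar>x\<bar> \<ge> 1 \<Longrightarrow> \<eta> x = 0"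
    and sparse: "\<And>m. \<bar>s (Suc m)\<bar> \<ge> \<bar>s m\<bar> + 2"
    and rapid_decay: "\<And>n. summable (\<lambda>m. (1 + (s m)\<^sup>2) ^ n * \<bar>a m\<bar>)"
begin

definition bump_sum :: "nat \<Rightarrow> real \<Rightarrow> real" where
  "bump_sum M x = (\<Sum>m<M. a m * \<eta> (x - s m))"

definition bump_limit :: "real \<Rightarrow> real" where
  "bump_limit x = (\<Sum>m. a m * \<eta> (x - s m))"

lemma abs_centre_add: "\<bar>s (m + i)\<bar> \<ge> \<bar>s m\<bar> + 2 * real i"
proof (induction i)
  case (Suc i)
  then show ?case using sparse[of "m + i"] by simp
qed simp

lemma abs_centre_ge: "\<bar>s m\<bar> \<ge> 2 * real m"
  using abs_centre_add[of 0 m] by simp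

lemma centres_separated:
  assumes "i \<noteq> j"
  shows "\<bar>s i - s j\<bar> \<ge> 2"
proof -
  have "\<bar>s i - s j\<bar> \<ge> 2" if "i < j" for i j
  proof -
    have "\<bar>s j\<bar> \<ge> \<bar>s i\<bar> + 2 * real (j - i)"
      using abs_centre_add[of i "j - i"] that by simp
    moreover have "real (j - i) \<ge> 1"
      using that by simp
    ultimately show ?thesis by linarith
  qed
  then show ?thesis
    using assms by (metis abs_minus_commute linorder_neqE_nat)
qed

lemma smooth_bump_shift: "smooth (\<lambda>x. \<eta> (x - c))"
  by (rule smooth_compose[OF smooth_bump]) (intro smooth_diff smooth_const smooth_ident)

lemma smooth_bump_term: "smooth (\<lambda>x. a m * \<eta> (x - s m))"
  by (intro smooth_mult smooth_const smooth_bump_shift)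

lemma smooth_bump_sum: "smooth (bump_sum M)"
  unfolding bump_sum_def by (intro smooth_sum smooth_bump_term)

text \<open>The centres with index at least M have modulus at least 2 M, so their bumps of radius 1
  do not reach \<open>x\<close>.\<close>

lemma bump_limit_eq_bump_sum:
  assumes "\<bar>x\<bar> \<le> 2 * real M - 1"
  shows "bump_limit x = bump_sum M x"
  unfolding bump_limit_def bump_sum_def
proof (rule suminf_finite)
  fix m assume "m \<notin> {..<M}"
  then have "real M \<le> real m" by simp
  then have "\<bar>x - s m\<bar> \<ge> 1"
    using abs_centre_ge[of m] assms by linarith
  then show "a m * \<eta> (x - s m) = 0"
    by (simp add: bump_support)
qed simp

lemma open_abs_less: "open {y::real. \<bar>y\<bar> < r}"
  by (intro open_Collect_less continuous_intros)

lemma smooth_bump_limit: "smooth bump_limit"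
proof (rule smooth_locally)
  fix x :: real
  define M where "M = nat \<lceil>\<bar>x\<bar>\<rceil> + 1"
  have "\<bar>x\<bar> < 2 * real M - 1"
    unfolding M_def by (simp, linarith)
  then show "\<exists>S g. open S \<and> x \<in> S \<and> smooth g \<and> (\<forall>y\<in>S. bump_limit y = g y)"
    by (intro exI[of _ "{y. \<bar>y\<bar> < 2 * real M - 1}"] exI[of _ "bump_sum M"])
      (auto simp: smooth_bump_sum bump_limit_eq_bump_sum open_abs_less)
qed

text \<open>Near \<open>x\<close> the tail is a finite sum, so differentiating it term by term
  raises no convergence question.\<close>

lemma higher_deriv_bump_tail:
  assumes "\<bar>x\<bar> < 2 * real N - 1" "M \<le> N"
  shows "(deriv ^^ j) (\<lambda>x. bump_sum M x - bump_limit x) x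
    = - (\<Sum>m\<in>{M..<N}. a m * (deriv ^^ j) \<eta> (x - s m))"
proof -
  have "bump_sum N y = bump_sum M y + (\<Sum>m\<in>{M..<N}. a m * \<eta> (y - s m))" for y
    unfolding bump_sum_def using assms(2)
    by (metis lessThan_atLeast0 sum.atLeastLessThan_concat zero_le)
  then have "bump_sum M y - bump_limit y = (-1) * (\<Sum>m\<in>{M..<N}. a m * \<eta> (y - s m))"
    if "y \<in> {y. \<bar>y\<bar> < 2 * real N - 1}" for y
    using that by (simp add: bump_limit_eq_bump_sum[of y N])
  then have "(deriv ^^ j) (\<lambda>x. bump_sum M x - bump_limit x) x
    = (deriv ^^ j) (\<lambda>x. (-1) * (\<Sum>m\<in>{M..<N}. a m * \<eta> (x - s m))) x"
    by (rule higher_deriv_cong_open[OF open_abs_less]) (use assms in auto)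
  also have "\<dots> = - (\<Sum>m\<in>{M..<N}. a m * (deriv ^^ j) \<eta> (x - s m))"
    using smooth_bump_term smooth_bump_shift smooth_bump
    by (simp add: higher_deriv_cmult_smooth[of _ _ "-1", simplified] smooth_sum
        higher_deriv_sum_smooth higher_deriv_cmult_smooth higher_deriv_shift)
  finally show ?thesis .
qed

lemma bump_schwartz: "\<eta> \<in> schwartz"
  by (rule schwartz_compact_support[OF smooth_bump, of 1]) (simp add: bump_support)

text \<open>The constant depends on \<open>n\<close> and \<open>j\<close> alone. Uniformity in
  \<open>M\<close> and \<open>x\<close> is what makes the tails of a convergent numerical series
  control a seminorm.\<close>

lemma bump_tail_bound:
  obtains c where "c > 0" "\<And>M x. (1 + x\<^sup>2) ^ n * \<bar>(deriv ^^ j) (\<lambda>x. bump_sum M x - bump_limit x) x\<bar>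
      \<le> c * (\<Sum>m. (1 + (s (m + M))\<^sup>2) ^ n * \<bar>a (m + M)\<bar>)"
proof -
  obtain c where c: "c > 0" "\<And>x s. (1 + x\<^sup>2) ^ n * \<bar>(deriv ^^ j) \<eta> (x - s)\<bar> \<le> c * (1 + s\<^sup>2) ^ n"
    using schwartz_shift_bound[OF bump_schwartz] by metis
  define b where "b m = (1 + (s m)\<^sup>2) ^ n * \<bar>a m\<bar>" for m
  have "(1 + x\<^sup>2) ^ n * \<bar>(deriv ^^ j) (\<lambda>x. bump_sum M x - bump_limit x) x\<bar> \<le> c * (\<Sum>m. b (m + M))" for M x
  proof -
    \<comment> \<open>\<open>N\<close> depends on \<open>x\<close>; this dependence disappears when
      the finite sum is enlarged to the whole tail.\<close>
    define N where "N = M + nat \<lceil>\<bar>x\<bar>\<rceil> + 1"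
    have N: "\<bar>x\<bar> < 2 * real N - 1" "M \<le> N"
      unfolding N_def by (simp, linarith) simp
    have "(1 + x\<^sup>2) ^ n * \<bar>(deriv ^^ j) (\<lambda>x. bump_sum M x - bump_limit x) x\<bar>
        = (1 + x\<^sup>2) ^ n * \<bar>\<Sum>m\<in>{M..<N}. a m * (deriv ^^ j) \<eta> (x - s m)\<bar>"
      by (simp add: higher_deriv_bump_tail[OF N])
    also have "\<dots> \<le> (1 + x\<^sup>2) ^ n * (\<Sum>m\<in>{M..<N}. \<bar>a m * (deriv ^^ j) \<eta> (x - s m)\<bar>)"
      by (intro mult_left_mono sum_abs) auto
    also have "\<dots> = (\<Sum>m\<in>{M..<N}. \<bar>a m\<bar> * ((1 + x\<^sup>2) ^ n * \<bar>(deriv ^^ j) \<eta> (x - s m)\<bar>))"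
      by (simp add: sum_distrib_left abs_mult mult_ac)
    also have "\<dots> \<le> (\<Sum>m\<in>{M..<N}. \<bar>a m\<bar> * (c * (1 + (s m)\<^sup>2) ^ n))"
      by (intro sum_mono mult_left_mono c(2)) auto
    also have "\<dots> = c * (\<Sum>m\<in>{M..<N}. b m)"
      by (simp add: sum_distrib_left b_def mult_ac)
    also have "(\<Sum>m\<in>{M..<N}. b m) = (\<Sum>m<N-M. b (m + M))"
      using sum.shift_bounds_nat_ivl[of b 0 M "N - M"] N(2) by (simp add: lessThan_atLeast0)
    also have "c * \<dots> \<le> c * (\<Sum>m. b (m + M))"
      using c(1) summable_ignore_initial_segment[OF rapid_decay[of n], of M]
      by (intro mult_left_mono sum_le_suminf) (auto simp: b_def)
    finally show ?thesis .
  qed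
  then show ?thesis
    using that c(1) unfolding b_def by blast
qed

lemma bump_limit_schwartz: "bump_limit \<in> schwartz"
proof -
  \<comment> \<open>The empty partial sum is 0, so the tail estimate with M = 0 is an estimate for
    the limit itself, up to sign.\<close>
  have "(\<lambda>x. bump_sum 0 x - bump_limit x) \<in> schwartz"
  proof (rule schwartzI)
    show "smooth (\<lambda>x. bump_sum 0 x - bump_limit x)"
      by (intro smooth_diff smooth_bump_sum smooth_bump_limit)
    show "\<exists>c. \<forall>x. (1 + x\<^sup>2) ^ n * \<bar>(deriv ^^ j) (\<lambda>x. bump_sum 0 x - bump_limit x) x\<bar> \<le> c" for n j
    proof -
      obtain c where "\<And>M x. (1 + x\<^sup>2) ^ n * \<bar>(deriv ^^ j) (\<lambda>x. bump_sum M x - bump_limit x) x\<bar>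
          \<le> c * (\<Sum>m. (1 + (s (m + M))\<^sup>2) ^ n * \<bar>a (m + M)\<bar>)"
        by (rule bump_tail_bound[of n j]) (rule that)
      from this[where M = 0] show ?thesis by blast
    qed
  qed
  from schwartz_cmult[OF this, of "-1"] show ?thesis
    by (simp add: bump_sum_def)
qed

lemma bump_sum_converges:
  assumes "e > 0"
  shows "\<exists>M. schwartz_seminorm n (\<lambda>x. bump_sum M x - bump_limit x) < ereal e"
proof -
  define t where "t M = (\<Sum>m. (1 + (s (m + M))\<^sup>2) ^ n * \<bar>a (m + M)\<bar>)" for M
  have "\<exists>c. c > 0 \<and> (\<forall>M x. (1 + x\<^sup>2) ^ n * \<bar>(deriv ^^ j) (\<lambda>x. bump_sum M x - bump_limit x) x\<bar> \<le> c * t M)" for j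
    unfolding t_def by (rule bump_tail_bound[of n j]) blast
  then obtain c where c: "\<And>j. c j > 0" "\<And>j M x. (1 + x\<^sup>2) ^ n * \<bar>(deriv ^^ j) (\<lambda>x. bump_sum M x - bump_limit x) x\<bar>
      \<le> c j * t M"
    by metis
  define C where "C = Max (c ` {..n})"
  have C: "c j \<le> C" if "j \<le> n" for j
    unfolding C_def using that by (intro Max_ge) auto
  have "C > 0"
    using C[of 0] c(1)[of 0] by linarith
  then obtain M where "norm (t M) < e / C"
    using suminf_exist_split[OF _ rapid_decay[of n], of "e / C"] assms unfolding t_def by auto
  then have "C * t M < e"
    using \<open>C > 0\<close> by (simp add: field_simps abs_mult) (smt (verit) mult_left_mono)
  have "t M \<ge> 0"
    unfolding t_def using summable_iff_shift[of "\<lambda>m. (1 + (s m)\<^sup>2) ^ n * \<bar>a m\<bar>" M] rapid_decay[of n]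
    by (intro suminf_nonneg) auto
  then have "schwartz_seminorm n (\<lambda>x. bump_sum M x - bump_limit x) \<le> ereal (C * t M)"
    by (intro schwartz_seminorm_le order.trans[OF c(2)] mult_right_mono C)
  also have "\<dots> < ereal e"
    using \<open>C * t M < e\<close> by simp
  finally show ?thesis by blast
qed

text \<open>All other centres are more than 3/2 away from \<open>x\<close>, so one bump contributes,
  and it is in its affine range.\<close>

lemma bump_limit_near_centre:
  assumes "\<bar>x - s m\<bar> < 1/2"
  shows "bump_limit x = a m * (1 + (x - s m))"
proof -
  have "bump_limit x = (\<Sum>i\<in>{m}. a i * \<eta> (x - s i))"
    unfolding bump_limit_def
  proof (rule suminf_finite)
    fix i assume "i \<notin> {m}"
    then have "\<bar>x - s i\<bar> \<ge> 1"
      using centres_separated[of i m] assms by (simp, linarith)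
    then show "a i * \<eta> (x - s i) = 0"
      by (simp add: bump_support)
  qed simp
  then show ?thesis
    using assms by (simp add: bump_linear)
qed

lemma bump_limit_centre: "bump_limit (s m) = a m"
  using bump_limit_near_centre[of "s m" m] by simp

lemma has_deriv_bump_limit_centre: "(bump_limit has_field_derivative a m) (at (s m))"
proof -
  have "((\<lambda>x. a m * (1 + (x - s m))) has_field_derivative a m) (at (s m))"
    by (auto intro!: derivative_eq_intros)
  then show ?thesis
    by (rule has_field_derivative_transform_within[of _ _ _ _ "1/2"])
      (auto simp: dist_real_def bump_limit_near_centre)
qed

end

text \<open>The spacing is measured through \<open>v\<close>, which is the identity for points in
  the source and the symbol itself when its values are to be the centres.\<close>

lemma sparse_sequence_exists:
  fixes v :: "'a \<Rightarrow> real"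
  assumes "\<And>m N. \<exists>x. \<bar>v x\<bar> > N \<and> P m x"
  obtains s :: "nat \<Rightarrow> 'a" where "\<And>m. P m (s m)" "\<And>m. \<bar>v (s m)\<bar> > L"
    "\<And>m. \<bar>v (s (Suc m))\<bar> \<ge> \<bar>v (s m)\<bar> + 2"
proof -
  have "\<exists>s. \<forall>m. (P m (s m) \<and> \<bar>v (s m)\<bar> > L) \<and> \<bar>v (s (Suc m))\<bar> \<ge> \<bar>v (s m)\<bar> + 2"
  proof (rule dependent_nat_choice)
    show "\<exists>x. P 0 x \<and> \<bar>v x\<bar> > L"
      using assms by blast
    show "\<exists>y. (P (Suc m) y \<and> \<bar>v y\<bar> > L) \<and> \<bar>v y\<bar> \<ge> \<bar>v x\<bar> + 2" if "P m x \<and> \<bar>v x\<bar> > L" for x m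
      using assms[of "max L (\<bar>v x\<bar> + 2)" "Suc m"] by (metis less_imp_le max_less_iff_conj)
  qed
  then show ?thesis
    using that by blast
qed

text \<open>For m \<ge> n the term is the inverse of q_m^(m - n), hence at most 2^(n - m): an
  exponent growing with the index beats any fixed one, however fast \<open>q\<close> grows.\<close>

lemma summable_power_mult_inverse_power:
  fixes q :: "nat \<Rightarrow> real"
  assumes "\<And>m. q m \<ge> 2"
  shows "summable (\<lambda>m. q m ^ n * inverse (q m ^ m))"
proof (rule summable_comparison_test_ev)
  show "summable (\<lambda>m. 2 ^ n * (1/2::real) ^ m)"
    by (intro summable_mult summable_geometric) auto
  have "norm (q m ^ n * inverse (q m ^ m)) \<le> 2 ^ n * (1/2) ^ m" if "n \<le> m" for m
  proof -
    have pos: "q m > 0"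
      using assms[of m] by linarith
    have m: "m = n + (m - n)"
      using that by simp
    have "q m ^ n * inverse (q m ^ m) = inverse (q m ^ (m - n))"
      using pos by (subst (2) m) (simp add: power_add field_simps)
    also have "\<dots> \<le> inverse (2 ^ (m - n))"
      using assms[of m] by (intro le_imp_inverse_le power_mono) auto
    also have "\<dots> = 2 ^ n * (1/2) ^ m"
      by (subst (2) m) (simp add: power_add power_one_over field_simps)
    finally show ?thesis
      using pos by simp
  qed
  then show "\<forall>\<^sub>F m in sequentially. norm (q m ^ n * inverse (q m ^ m)) \<le> 2 ^ n * (1/2) ^ m"
    unfolding eventually_sequentially by blast
qed

section \<open>Symbols that are injective near infinity\<close>

text \<open>By Rolle, two equal values would produce a zero of the derivative between them, still in
  the interval \<open>S\<close>; a continuous injection on an interval is strictly monotone.\<close>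

lemma injective_end_strict_mono:
  fixes \<phi> :: "real \<Rightarrow> real"
  assumes S: "is_interval S" "S \<subseteq> {x. \<bar>x\<bar> > k}"
    and \<phi>: "\<And>x. (\<phi> has_field_derivative \<phi>' x) (at x)" "\<And>x. \<bar>x\<bar> > k \<Longrightarrow> \<phi>' x \<noteq> 0"
  shows "strict_mono_on S \<phi> \<or> strict_antimono_on S \<phi>"
proof -
  have "inj_on \<phi> S"
  proof (rule linorder_inj_onI')
    fix x y assume xy: "x \<in> S" "y \<in> S" "x < y"
    show "\<phi> x \<noteq> \<phi> y"
    proof
      assume "\<phi> x = \<phi> y"
      moreover have "continuous_on {x..y} \<phi>"
        using \<phi>(1) by (intro DERIV_continuous_on) (blast intro: has_field_derivative_at_within)
      moreover have "(\<phi> has_derivative (*) (\<phi>' z)) (at z)" for z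
        using \<phi>(1)[of z] by (simp add: has_field_derivative_def)
      ultimately obtain z where z: "x < z" "z < y" "(*) (\<phi>' z) = (\<lambda>v. 0)"
        using Rolle_deriv[OF xy(3), of \<phi> "\<lambda>z. (*) (\<phi>' z)"] by blast
      then have "\<phi>' z = 0"
        by (metis mult.right_neutral)
      moreover have "z \<in> S"
        using mem_is_interval_1_I[OF S(1) xy(1,2)] z by simp
      ultimately show False
        using S(2) \<phi>(2) by blast
    qed
  qed
  moreover have "continuous_on S \<phi>"
    using \<phi>(1) by (intro DERIV_continuous_on) (blast intro: has_field_derivative_at_within)
  ultimately show ?thesis
    using injective_eq_monotone_map[OF S(1)] by blast
qed

text \<open>
  Surjectivity forces the two ends of \<open>\<phi>\<close> to run to opposite infinities, so that values taken far
  out are taken only once.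
\<close>

lemma unique_preimage_near_infinity_aux:
  fixes \<phi> :: "real \<Rightarrow> real"
  assumes \<phi>: "\<And>x. (\<phi> has_field_derivative \<phi>' x) (at x)" "\<And>x. \<bar>x\<bar> > k \<Longrightarrow> \<phi>' x \<noteq> 0"
    and surj: "surj \<phi>" and a: "a > k" "a > 0" and mono: "strict_mono_on {a..} \<phi>"
  shows "\<exists>K\<ge>a. \<forall>x z. \<bar>x\<bar> > K \<longrightarrow> \<phi> z = \<phi> x \<longrightarrow> z = x"
proof -
  have "continuous_on {-a..a} \<phi>"
    using \<phi>(1) by (intro DERIV_continuous_on) (blast intro: has_field_derivative_at_within)
  then have "bounded (\<phi> ` {-a..a})"
    by (intro compact_imp_bounded compact_continuous_image compact_Icc)
  then obtain b where b: "\<forall>y\<in>\<phi> ` {-a..a}. norm y \<le> b"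
    unfolding bounded_iff by blast
  have mid: "\<bar>\<phi> x\<bar> \<le> b" if "-a \<le> x" "x \<le> a" for x
    using b that by auto
  have right: "\<phi> x \<ge> - b" if "x \<ge> a" for x
  proof -
    have "\<phi> a \<le> \<phi> x"
      using mono that by (cases "x = a") (auto simp: monotone_on_def less_le)
    then show ?thesis
      using mid[of a] a by linarith
  qed
  have "strict_mono_on {..-a} \<phi> \<or> strict_antimono_on {..-a} \<phi>"
    using a by (intro injective_end_strict_mono[OF _ _ \<phi>]) (auto simp: is_interval_1)
  \<comment> \<open>If \<phi> also rose towards minus infinity, it would be bounded below by -b
    everywhere and miss the value -b - 1.\<close>
  moreover have "\<not> strict_antimono_on {..-a} \<phi>"
  proof
    assume anti: "strict_antimono_on {..-a} \<phi>"
    have "\<phi> x \<ge> - b" if "x \<le> -a" for x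
    proof -
      have "\<phi> (-a) \<le> \<phi> x"
        using anti that by (cases "x = -a") (auto simp: monotone_on_def less_le)
      then show ?thesis
        using mid[of "-a"] a by linarith
    qed
    then have "\<phi> x \<ge> - b" for x
      using right[of x] mid[of x] by (smt (verit))
    then have "\<phi> (inv \<phi> (- b - 1)) \<ge> - b"
      by blast
    then show False
      by (simp add: surj_f_inv_f[OF surj])
  qed
  ultimately have mono': "strict_mono_on {..-a} \<phi>"
    by blast
  have left: "\<phi> x \<le> b" if "x \<le> -a" for x
  proof -
    have "\<phi> x \<le> \<phi> (-a)"
      using mono' that by (cases "x = -a") (auto simp: monotone_on_def less_le)
    then show ?thesis
      using mid[of "-a"] a by linarith
  qed
  \<comment> \<open>The left end and the middle stay at or below b, the right end and the middle at
    or above -b. So b + 1 is attained on the right end, -b - 1 on the left end, and the values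
    beyond \<open>p\<close> and \<open>q\<close> belong to one end each.\<close>
  obtain p where p: "\<phi> p = b + 1"
    using surj by (metis surjD)
  obtain q where q: "\<phi> q = - b - 1"
    using surj by (metis surjD)
  have "p \<ge> a"
    using left[of p] mid[of p] p by (smt (verit))
  have "q \<le> -a"
    using right[of q] mid[of q] q by (smt (verit))
  define K where "K = max p (- q)"
  have "z = x" if x: "\<bar>x\<bar> > K" and eq: "\<phi> z = \<phi> x" for x z
  proof (cases "x > 0")
    case True
    then have "x > p"
      using x by (simp add: K_def)
    then have "\<phi> x > b"
      using strict_mono_onD[OF mono, of p x] \<open>p \<ge> a\<close> p by simp
    then have "z \<ge> a"
      using left[of z] mid[of z] eq by (smt (verit))
    then show ?thesis
      using strict_mono_on_eqD[OF mono eq] \<open>x > p\<close> \<open>p \<ge> a\<close> by simp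
  next
    case False
    then have "x < q"
      using x by (simp add: K_def)
    then have "\<phi> x < - b"
      using strict_mono_onD[OF mono', of x q] \<open>q \<le> -a\<close> q by simp
    then have "z \<le> -a"
      using right[of z] mid[of z] eq by (smt (verit))
    then show ?thesis
      using strict_mono_on_eqD[OF mono' eq] \<open>x < q\<close> \<open>q \<le> -a\<close> by simp
  qed
  moreover have "K \<ge> a"
    using \<open>p \<ge> a\<close> by (simp add: K_def)
  ultimately show ?thesis by blast
qed

text \<open>Passing to -\<phi> changes neither surjectivity nor the coincidence of values and makes
  a decreasing right end increasing.\<close>

lemma unique_preimage_near_infinity:
  fixes \<phi> :: "real \<Rightarrow> real"
  assumes \<phi>: "\<And>x. (\<phi> has_field_derivative \<phi>' x) (at x)" "\<And>x. \<bar>x\<bar> > k \<Longrightarrow> \<phi>' x \<noteq> 0"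
    and surj: "surj \<phi>"
  obtains K where "K > 0" "K > k" "\<And>x z. \<bar>x\<bar> > K \<Longrightarrow> \<phi> z = \<phi> x \<Longrightarrow> z = x"
proof -
  define a where "a = max k 0 + 1"
  have a: "a > k" "a > 0"
    unfolding a_def by auto
  have "strict_mono_on {a..} \<phi> \<or> strict_antimono_on {a..} \<phi>"
    using a by (intro injective_end_strict_mono[OF _ _ \<phi>]) (auto simp: is_interval_1)
  then have "\<exists>K\<ge>a. \<forall>x z. \<bar>x\<bar> > K \<longrightarrow> \<phi> z = \<phi> x \<longrightarrow> z = x"
  proof
    assume "strict_mono_on {a..} \<phi>"
    then show ?thesis
      using \<phi>(2) by (intro unique_preimage_near_infinity_aux[OF \<phi>(1) _ surj a])
  next
    assume anti: "strict_antimono_on {a..} \<phi>"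
    have "((\<lambda>x. - \<phi> x) has_field_derivative - \<phi>' x) (at x)" for x
      by (intro DERIV_minus \<phi>(1))
    moreover have "- \<phi>' x \<noteq> 0" if "\<bar>x\<bar> > k" for x
      using \<phi>(2)[OF that] by simp
    moreover have "surj (\<lambda>x. - \<phi> x)"
      using surj by (metis surj_def minus_minus)
    moreover have "strict_mono_on {a..} (\<lambda>x. - \<phi> x)"
      using anti by (auto simp: monotone_on_def)
    ultimately have "\<exists>K\<ge>a. \<forall>x z. \<bar>x\<bar> > K \<longrightarrow> - \<phi> z = - \<phi> x \<longrightarrow> z = x"
      by (intro unique_preimage_near_infinity_aux[OF _ _ _ a])
    then show ?thesis by simp
  qed
  then obtain K where "K \<ge> a" "\<forall>x z. \<bar>x\<bar> > K \<longrightarrow> \<phi> z = \<phi> x \<longrightarrow> z = x"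
    by blast
  then show ?thesis
    using a by (intro that[of K]) auto
qed

section \<open>The inverse of the symbol near infinity\<close>

locale injective_near_infinity =
  fixes \<phi> :: "real \<Rightarrow> real" and K :: real
  assumes smooth_symbol: "smooth \<phi>"
    and surj_symbol: "surj \<phi>"
    and K_pos: "K > 0"
    and deriv_nonzero: "\<And>x. \<bar>x\<bar> > K \<Longrightarrow> deriv \<phi> x \<noteq> 0"
    and unique_preimage: "\<And>x z. \<bar>x\<bar> > K \<Longrightarrow> \<phi> z = \<phi> x \<Longrightarrow> z = x"
begin

lemma symbol_inv: "\<phi> (inv \<phi> y) = y"
  by (rule surj_f_inv_f[OF surj_symbol])

text \<open>\<open>inv \<phi>\<close> picks an arbitrary preimage; surjectivity makes it a right
  inverse everywhere, uniqueness of far preimages makes it a left inverse far out.\<close>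

lemma inv_symbol: "\<bar>x\<bar> > K \<Longrightarrow> inv \<phi> (\<phi> x) = x"
  using unique_preimage symbol_inv by blast

lemma isCont_inv:
  assumes "\<bar>inv \<phi> y\<bar> > K"
  shows "isCont (inv \<phi>) y"
proof -
  define x where "x = inv \<phi> y"
  \<comment> \<open>Half the distance to the bound \<open>K\<close> keeps the closed interval of
    radius \<open>d\<close> around \<open>x\<close> in the region where \<open>inv \<phi>\<close> is
    a left inverse.\<close>
  define d where "d = (\<bar>x\<bar> - K) / 2"
  have "d > 0"
    using assms by (simp add: d_def x_def)
  moreover have "inv \<phi> (\<phi> z) = z" if "\<bar>z - x\<bar> \<le> d" for z
  proof (rule inv_symbol)
    have "\<bar>x\<bar> - \<bar>z\<bar> \<le> d"
      using that by linarith
    then show "\<bar>z\<bar> > K"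
      using \<open>d > 0\<close> unfolding d_def by (simp add: field_simps)
  qed
  ultimately have "isCont (inv \<phi>) (\<phi> x)"
    using smooth_isCont[OF smooth_symbol]
    by (intro isCont_inverse_function[where f = \<phi> and d = d]) auto
  then show ?thesis
    by (simp add: x_def symbol_inv)
qed

text \<open>Continuity of \<open>inv \<phi>\<close> is known at the points of this set and may fail
  elsewhere, so openness is checked point by point and not as a preimage.\<close>

lemma open_far_values: "open {y. \<bar>inv \<phi> y\<bar> > K}"
proof (rule openI)
  fix y assume "y \<in> {y. \<bar>inv \<phi> y\<bar> > K}"
  then have y: "\<bar>inv \<phi> y\<bar> > K" by simp
  have "((\<lambda>y. \<bar>inv \<phi> y\<bar>) \<longlongrightarrow> \<bar>inv \<phi> y\<bar>) (nhds y)"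
    using isCont_inv[OF y] by (intro tendsto_rabs) (simp add: isCont_def tendsto_nhds_iff)
  then have "\<forall>\<^sub>F z in nhds y. \<bar>inv \<phi> z\<bar> > K"
    using y by (rule order_tendstoD)
  then show "\<exists>e>0. ball y e \<subseteq> {y. \<bar>inv \<phi> y\<bar> > K}"
    unfolding eventually_nhds_metric by (auto simp: dist_commute subset_iff)
qed

lemma has_deriv_inv:
  assumes "\<bar>inv \<phi> y\<bar> > K"
  shows "(inv \<phi> has_field_derivative inverse (deriv \<phi> (inv \<phi> y))) (at y)"
  by (rule DERIV_inverse_function[where f = \<phi> and a = "y - 1" and b = "y + 1"])
    (simp_all add: smooth_has_deriv[OF smooth_symbol] deriv_nonzero[OF assms] isCont_inv[OF assms] symbol_inv)

text \<open>Bootstrapping: the derivative of the inverse is 1 / \<phi>' composed with the inverse,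
  so \<open>k\<close> derivatives of the inverse yield one more.\<close>

lemma ndiff_on_inv: "ndiff_on k {y. \<bar>inv \<phi> y\<bar> > K} (inv \<phi>)"
proof (induction k)
  case (Suc k)
  have "ndiff_on k UNIV (deriv \<phi>)"
    using smooth_deriv[OF smooth_symbol] by (simp add: smooth_iff_ndiff_on)
  then have "ndiff_on k {y. \<bar>inv \<phi> y\<bar> > K} (\<lambda>y. deriv \<phi> (inv \<phi> y))"
    by (rule ndiff_on_compose[OF open_far_values open_UNIV UNIV_I _ Suc])
  then have "ndiff_on k {y. \<bar>inv \<phi> y\<bar> > K} (\<lambda>y. inverse (deriv \<phi> (inv \<phi> y)))"
    by (intro ndiff_on_inverse[OF open_far_values]) (simp add: deriv_nonzero)
  then show ?case
    by (intro ndiff_on_SucI[OF open_far_values]) (auto intro: has_deriv_inv)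
qed simp

text \<open>The bump is carried to the target by \<open>inv \<phi>\<close>, which is smooth on far
  values and uncontrolled on the others; there the bump already vanishes. The margin 1 in the bound
  on \<open>c\<close> keeps its whole support beyond \<open>K\<close>.\<close>

lemma bump_in_range:
  assumes smooth: "smooth \<eta>" and support: "\<And>x. \<bar>x\<bar> \<ge> 1 \<Longrightarrow> \<eta> x = 0" and c: "\<bar>c\<bar> > K + 1"
  shows "(\<lambda>y. \<eta> (inv \<phi> y - c)) \<in> schwartz" "\<eta> (inv \<phi> (\<phi> x) - c) = \<eta> (x - c)"
proof -
  let ?f = "\<lambda>y. \<eta> (inv \<phi> y - c)" and ?V = "{y. \<bar>inv \<phi> y\<bar> > K}" and ?W = "- \<phi> ` {c-1..c+1}"
  have comp: "compact (\<phi> ` {c-1..c+1})"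
    by (intro compact_continuous_image compact_Icc continuous_at_imp_continuous_on ballI
        smooth_isCont smooth_symbol)
  have vanish: "?f y = 0" if "y \<in> ?W" for y
  proof (rule support)
    have "inv \<phi> y \<notin> {c-1..c+1}"
      using that symbol_inv[of y] by force
    then show "\<bar>inv \<phi> y - c\<bar> \<ge> 1"
      by auto
  qed
  have "ndiff_on k UNIV ?f" for k
  proof -
    have "ndiff_on k ?V (\<lambda>y. inv \<phi> y + (- c))"
      by (intro ndiff_on_add ndiff_on_const ndiff_on_inv open_far_values)
    moreover have "ndiff_on k UNIV \<eta>"
      using smooth by (simp add: smooth_iff_ndiff_on)
    ultimately have "ndiff_on k ?V (\<lambda>y. \<eta> (inv \<phi> y + (- c)))"
      using ndiff_on_compose[OF open_far_values open_UNIV UNIV_I, of k \<eta> "\<lambda>y. inv \<phi> y + (- c)"] by blast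
    then have V: "ndiff_on k ?V ?f"
      by simp
    have "open ?W"
      using compact_imp_closed[OF comp] by (simp add: open_closed)
    then have W: "ndiff_on k ?W ?f"
      using vanish by (intro ndiff_on_cong[OF _ _ ndiff_on_const[of ?W k 0]]) auto
    \<comment> \<open>A value outside \<open>?W\<close> is \<phi>(x) with x within 1 of
      \<open>c\<close>, hence |x| > K and \<open>inv \<phi>\<close> returns this x.\<close>
    have "?V \<union> ?W = UNIV"
    proof (rule equalityI[OF subset_UNIV], rule subsetI)
      fix y
      have "\<bar>x\<bar> > K" if "x \<in> {c-1..c+1}" for x
        using that c by auto
      then show "y \<in> ?V \<union> ?W"
        using inv_symbol by fastforce
    qed
    then show ?thesis
      using ndiff_on_Un[OF V W] by simp
  qed
  then have "smooth ?f"
    by (simp add: smooth_iff_ndiff_on)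
  moreover obtain R where R: "\<forall>y\<in>\<phi> ` {c-1..c+1}. norm y \<le> R"
    using compact_imp_bounded[OF comp] unfolding bounded_iff by blast
  have "?f y = 0" if "\<bar>y\<bar> > R" for y
  proof (rule vanish)
    show "y \<in> ?W"
      using R that by (metis ComplI linorder_not_less real_norm_def)
  qed
  ultimately show "?f \<in> schwartz"
    by (rule schwartz_compact_support)
  show "\<eta> (inv \<phi> (\<phi> x) - c) = \<eta> (x - c)"
  proof (cases "\<bar>x\<bar> > K")
    case True
    then show ?thesis by (simp add: inv_symbol)
  next
    case False
    \<comment> \<open>For |x| \<le> K the chosen preimage may differ from \<open>x\<close>, but it
      also has modulus at most \<open>K\<close>, so both sides of the claim are 0.\<close>
    have "\<not> \<bar>inv \<phi> (\<phi> x)\<bar> > K"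
    proof
      assume "\<bar>inv \<phi> (\<phi> x)\<bar> > K"
      from unique_preimage[OF this, of x] have "x = inv \<phi> (\<phi> x)"
        by (simp add: symbol_inv)
      then show False
        using \<open>\<bar>inv \<phi> (\<phi> x)\<bar> > K\<close> False by simp
    qed
    moreover have "\<bar>z - c\<bar> \<ge> 1" if "\<not> \<bar>z\<bar> > K" for z
      using that c by linarith
    ultimately show ?thesis
      using False by (simp add: support)
  qed
qed

lemma bump_limit_in_range:
  assumes closed: "schwartz_closed_range (comp_op \<phi>)"
    and bumps: "bump_series \<eta> s a" and far: "\<And>m. \<bar>s m\<bar> > K + 1"
  obtains f where "f \<in> schwartz" "\<And>x. f (\<phi> x) = bump_series.bump_limit \<eta> s a x"
proof -
  interpret bump_series \<eta> s a by fact
  have in_range: "bump_sum M \<in> comp_op \<phi> ` schwartz" for M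
  proof (rule image_eqI)
    show "(\<lambda>y. \<Sum>m<M. a m * \<eta> (inv \<phi> y - s m)) \<in> schwartz"
      by (intro schwartz_sum schwartz_cmult bump_in_range(1) smooth_bump bump_support far)
    show "bump_sum M = comp_op \<phi> (\<lambda>y. \<Sum>m<M. a m * \<eta> (inv \<phi> y - s m))"
      by (rule ext) (simp add: comp_op_def bump_sum_def bump_in_range(2)[OF smooth_bump bump_support far])
  qed
  have "bump_limit \<in> comp_op \<phi> ` schwartz"
    by (rule closedin_schwartz_topology_sequentially[OF closed[unfolded schwartz_closed_range_def]
          bump_limit_schwartz in_range bump_sum_converges])
  then obtain f where "f \<in> schwartz" "bump_limit = f \<circ> \<phi>"
    unfolding comp_op_def by blast
  then show ?thesis
    by (intro that[of f]) auto
qed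

text \<open>
  The series \<open>\<Sum>m. a m * \<eta> (x - s m)\<close> has the form \<open>f \<circ> \<phi>\<close>, and \<open>f (\<phi> (s m)) = a m\<close>,
  \<open>f' (\<phi> (s m)) = a m / \<phi>' (s m)\<close>; the Schwartz bounds for \<open>f\<close> would then fail along \<open>s\<close>.
\<close>

lemma growth_bound:
  assumes closed: "schwartz_closed_range (comp_op \<phi>)"
  obtains p N where "\<And>x. \<bar>x\<bar> > N \<Longrightarrow> 1 + (\<phi> x)\<^sup>2 + 1 / \<bar>deriv \<phi> x\<bar> \<le> (1 + x\<^sup>2) ^ p"
proof (rule ccontr)
  \<comment> \<open>Adding the two quantities lets one sequence treat both: along it the sum is
    large, whichever summand is responsible.\<close>
  define h where "h x = 1 + (\<phi> x)\<^sup>2 + 1 / \<bar>deriv \<phi> x\<bar>" for x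
  assume "\<not> thesis"
  \<comment> \<open>Of the exponent 2 m, one half is cancelled by the coefficient
    \<open>a m\<close>; the other leaves at least 2^m against the fixed bound c + d.\<close>
  then have "\<exists>x. \<bar>x\<bar> > N \<and> h x > (1 + x\<^sup>2) ^ (2 * m)" for m N
    using that[of N "2 * m"] unfolding h_def by (meson linorder_not_le)
  then obtain s where s: "\<And>m. h (s m) > (1 + (s m)\<^sup>2) ^ (2 * m)" "\<And>m. \<bar>s m\<bar> > K + 1"
    "\<And>m. \<bar>s (Suc m)\<bar> \<ge> \<bar>s m\<bar> + 2"
    using sparse_sequence_exists[where v = "\<lambda>x. x" and P = "\<lambda>m x. h x > (1 + x\<^sup>2) ^ (2 * m)" and L = "K + 1"]
    by metis
  define q where "q m = 1 + (s m)\<^sup>2" for m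
  have q: "q m \<ge> 2" for m
  proof -
    have "1 \<le> \<bar>s m\<bar>"
      using s(2)[of m] K_pos by linarith
    then have "1 \<le> \<bar>s m\<bar>\<^sup>2"
      by (rule one_le_power)
    then show ?thesis
      by (simp add: q_def)
  qed
  define a where "a m = inverse (q m ^ m)" for m
  have q_pos: "q m > 0" for m
    using q[of m] by linarith
  then have a_pos: "a m > 0" for m
    by (simp add: a_def)
  obtain \<eta> :: "real \<Rightarrow> real" where \<eta>: "smooth \<eta>" "\<And>x. \<bar>x\<bar> \<le> 1/2 \<Longrightarrow> \<eta> x = 1 + x"
    "\<And>x. \<bar>x\<bar> \<ge> 1 \<Longrightarrow> \<eta> x = 0"
    by (rule smooth_linear_bump_exists) blast
  have "summable (\<lambda>m. (1 + (s m)\<^sup>2) ^ n * \<bar>a m\<bar>)" for n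
    using summable_power_mult_inverse_power[of q n, OF q] a_pos
    by (simp add: q_def[symmetric] a_def[symmetric] abs_of_pos)
  then have bumps: "bump_series \<eta> s a"
    using \<eta> s(3) by (intro bump_series.intro) auto
  interpret bump_series \<eta> s a by (rule bumps)
  obtain f where f: "f \<in> schwartz" "\<And>x. f (\<phi> x) = bump_limit x"
    using bump_limit_in_range[OF closed bumps s(2)] by blast
  obtain c where c: "\<And>y. (1 + y\<^sup>2) * \<bar>f y\<bar> \<le> c"
    using schwartzD[OF f(1), of 1 0] by (metis funpow_0 power_one_right)
  obtain d where d: "\<And>y. \<bar>deriv f y\<bar> \<le> d"
    using schwartzD[OF f(1), of 0 1] by (auto simp: funpow.simps)
  have "2 ^ m < c + d" for m
  proof -
    have nz: "deriv \<phi> (s m) \<noteq> 0"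
      by (rule deriv_nonzero) (use s(2)[of m] in linarith)
    have "bump_limit = (\<lambda>x. f (\<phi> x))"
      using f(2) by auto
    then have "(bump_limit has_field_derivative deriv f (\<phi> (s m)) * deriv \<phi> (s m)) (at (s m))"
      using DERIV_chain2[OF smooth_has_deriv[OF schwartz_smooth[OF f(1)]] smooth_has_deriv[OF smooth_symbol]]
      by simp
    then have "a m = deriv f (\<phi> (s m)) * deriv \<phi> (s m)"
      using has_deriv_bump_limit_centre DERIV_unique by blast
    then have "a m = \<bar>deriv f (\<phi> (s m))\<bar> * \<bar>deriv \<phi> (s m)\<bar>"
      using a_pos[of m] by (metis abs_mult abs_of_pos)
    then have "a m * (1 / \<bar>deriv \<phi> (s m)\<bar>) \<le> d"
      using d[of "\<phi> (s m)"] nz by simp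
    moreover have "a m * (1 + (\<phi> (s m))\<^sup>2) \<le> c"
      using c[of "\<phi> (s m)"] a_pos[of m] by (simp add: f(2) bump_limit_centre mult.commute)
    ultimately have "a m * h (s m) \<le> c + d"
      unfolding h_def by (simp add: distrib_left)
    moreover have "a m * q m ^ (2 * m) < a m * h (s m)"
      using s(1)[of m] a_pos[of m] by (intro mult_strict_left_mono) (simp_all add: q_def)
    moreover have "a m * q m ^ (2 * m) = q m ^ m"
      using q_pos[of m] by (simp add: a_def mult_2 power_add)
    moreover have "2 ^ m \<le> q m ^ m"
      using q by (intro power_mono) auto
    ultimately show ?thesis by linarith
  qed
  moreover obtain m where "c + d < 2 ^ m"
    using real_arch_pow[of 2 "c + d"] by auto
  ultimately show False
    by (meson less_asym)
qed

end

section \<open>Growth of the derivatives of a symbol\<close>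

lemma bounded_on_interval:
  fixes f :: "real \<Rightarrow> real"
  assumes "smooth f"
  obtains b where "\<And>x. \<bar>x\<bar> \<le> R \<Longrightarrow> \<bar>f x\<bar> \<le> b"
proof -
  have "bounded (f ` {-R..R})"
    by (intro compact_imp_bounded compact_continuous_image compact_Icc
        continuous_at_imp_continuous_on ballI smooth_isCont assms)
  then obtain b where "\<forall>y\<in>f ` {-R..R}. norm y \<le> b"
    unfolding bounded_iff by blast
  then show ?thesis
    by (intro that[of b]) (auto simp: abs_le_iff)
qed

text \<open>Composing with a cutoff that is 1 on [-N, N] gives a Schwartz function equal to 1
  wherever |\<phi>| \<le> N; its decay confines these points. This makes \<phi> large at far points,
  as sparse centres require.\<close>

lemma symbol_proper:
  assumes "schwartz_symbol \<phi>"
  obtains R where "\<And>x. \<bar>\<phi> x\<bar> \<le> N \<Longrightarrow> \<bar>x\<bar> \<le> R"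
proof -
  obtain \<beta> :: "real \<Rightarrow> real" where \<beta>: "smooth \<beta>" "\<And>x. \<bar>x\<bar> \<le> 1/2 \<Longrightarrow> \<beta> x = 1"
    "\<And>x. \<bar>x\<bar> \<ge> 1 \<Longrightarrow> \<beta> x = 0"
    by (rule smooth_cutoff_exists) blast
  \<comment> \<open>The cutoff is 1 up to half its radius, hence the factor 2; the maximum keeps
    \<open>r\<close> positive for any N.\<close>
  define r where "r = 2 * max N 1"
  have r: "r > 0" "r \<ge> 2 * N"
    unfolding r_def by auto
  define f where "f y = \<beta> (inverse r * y)" for y
  have "smooth f"
    unfolding f_def by (rule smooth_compose[OF \<beta>(1)]) (intro smooth_mult smooth_const smooth_ident)
  moreover have "f y = 0" if "\<bar>y\<bar> > r" for y
    using that r unfolding f_def by (intro \<beta>(3)) (simp add: abs_mult field_simps)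
  ultimately have "f \<in> schwartz"
    by (rule schwartz_compact_support)
  then have "f \<circ> \<phi> \<in> schwartz"
    using assms by (simp add: schwartz_symbol_def)
  then obtain c where c: "\<And>x. (1 + x\<^sup>2) ^ 1 * \<bar>(deriv ^^ 0) (f \<circ> \<phi>) x\<bar> \<le> c"
    by (rule schwartzD) blast
  have "\<bar>x\<bar> \<le> c" if "\<bar>\<phi> x\<bar> \<le> N" for x
  proof -
    have "f (\<phi> x) = 1"
      using that r unfolding f_def by (intro \<beta>(2)) (simp add: abs_mult field_simps)
    then have "1 + x\<^sup>2 \<le> c"
      using c[of x] by simp
    moreover have "\<bar>x\<bar> \<le> 1 + x\<^sup>2"
      using sum_squares_bound[of "\<bar>x\<bar>" 1] by simp
    ultimately show ?thesis by linarith
  qed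
  then show ?thesis by (rule that)
qed

text \<open>
  With \<open>f\<close> affine near each \<open>\<phi> (x m)\<close>, the \<open>j\<close>-th derivative of \<open>f \<circ> \<phi>\<close> at \<open>x m\<close> is just
  \<open>a m\<close> times that of \<open>\<phi>\<close>, with no further terms from Faa di Bruno's formula.
\<close>

lemma higher_deriv_symbol_poly_bounded:
  assumes symbol: "schwartz_symbol \<phi>" and growth: "poly_bounded \<phi>"
  shows "poly_bounded ((deriv ^^ j) \<phi>)"
proof (rule ccontr)
  let ?D = "(deriv ^^ j) \<phi>"
  assume not_bounded: "\<not> poly_bounded ?D"
  then have "j > 0"
    using growth by (cases j) auto
  have smooth: "smooth \<phi>"
    using symbol by (simp add: schwartz_symbol_def)
  have "\<exists>x. \<bar>\<phi> x\<bar> > N \<and> (\<bar>x\<bar> \<ge> real m + 1 \<and> \<bar>?D x\<bar> > (1 + x\<^sup>2) ^ m)" for m N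
  proof -
    obtain R where R: "\<And>x. \<bar>\<phi> x\<bar> \<le> N \<Longrightarrow> \<bar>x\<bar> \<le> R"
      using symbol_proper[OF symbol, of N] by blast
    obtain b where b: "\<And>x. \<bar>x\<bar> \<le> max R (real m + 1) \<Longrightarrow> \<bar>?D x\<bar> \<le> b"
      using bounded_on_interval[OF smooth_higher_deriv[OF smooth]] by blast
    \<comment> \<open>The two entries of \<open>max b 1\<close> serve different ends:
      \<open>b\<close> excludes the interval where \<open>?D\<close> is bounded by it, and 1 retains
      growth beyond the plain m-th power.\<close>
    obtain x where x: "\<bar>?D x\<bar> > max b 1 * (1 + x\<^sup>2) ^ m"
      using not_bounded unfolding poly_bounded_def by (meson linorder_not_le)
    have one: "(1 + x\<^sup>2) ^ m \<ge> 1"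
      by (intro one_le_power) simp
    have "max b 1 * 1 \<le> max b 1 * (1 + x\<^sup>2) ^ m"
      using one by (intro mult_left_mono) auto
    then have "b < \<bar>?D x\<bar>"
      using x by linarith
    then have "\<bar>x\<bar> > max R (real m + 1)"
      using b[of x] by linarith
    moreover have "1 * (1 + x\<^sup>2) ^ m \<le> max b 1 * (1 + x\<^sup>2) ^ m"
      using one by (intro mult_right_mono) auto
    ultimately show ?thesis
      using R[of x] x by (intro exI[of _ x]) force
  qed
  then obtain x where x: "\<And>m. \<bar>x m\<bar> \<ge> real m + 1 \<and> \<bar>?D (x m)\<bar> > (1 + (x m)\<^sup>2) ^ m"
    "\<And>m. \<bar>\<phi> (x (Suc m))\<bar> \<ge> \<bar>\<phi> (x m)\<bar> + 2"
    using sparse_sequence_exists[where v = \<phi> and L = 0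
        and P = "\<lambda>m x. \<bar>x\<bar> \<ge> real m + 1 \<and> \<bar>?D x\<bar> > (1 + x\<^sup>2) ^ m"] by metis
  define q where "q m = 1 + (x m)\<^sup>2" for m
  \<comment> \<open>Growth of the weight with m suffices for the end of the proof: there the weight
    itself, to the power 1, is squeezed below a constant.\<close>
  have q_ge: "q m \<ge> real m + 2" for m
  proof -
    have "real m + 1 \<le> \<bar>x m\<bar>" "1 \<le> \<bar>x m\<bar>"
      using x(1)[of m] by auto
    then have "\<bar>x m\<bar> * 1 \<le> \<bar>x m\<bar> * \<bar>x m\<bar>"
      by (intro mult_left_mono) auto
    then show ?thesis
      using \<open>real m + 1 \<le> \<bar>x m\<bar>\<close> by (simp add: q_def power2_eq_square)
  qed
  have q: "q m \<ge> 2" "q m > 0" for m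
    using q_ge[of m] by linarith+
  define a where "a m = inverse (q m ^ m)" for m
  have a_pos: "a m > 0" for m
    using q by (simp add: a_def)
  obtain c p where cp: "\<And>x. \<bar>\<phi> x\<bar> \<le> c * (1 + x\<^sup>2) ^ p"
    using growth unfolding poly_bounded_def by blast
  \<comment> \<open>Here polynomial growth enters: the weight at the target centre is a fixed power
    of the weight \<open>q m\<close>, against which the coefficients are negligible.\<close>
  have phi_sq: "1 + (\<phi> (x m))\<^sup>2 \<le> (1 + c\<^sup>2) * q m ^ (2 * p)" for m
  proof -
    have "\<bar>\<phi> (x m)\<bar>\<^sup>2 \<le> (c * q m ^ p)\<^sup>2"
      using cp[of "x m"] by (intro power_mono) (auto simp: q_def)
    moreover have "1 \<le> q m ^ (2 * p)"
      using q[of m] by (intro one_le_power) linarith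
    ultimately show ?thesis
      by (simp add: power_mult_distrib power_even_eq distrib_right)
  qed
  obtain \<eta> :: "real \<Rightarrow> real" where \<eta>: "smooth \<eta>" "\<And>x. \<bar>x\<bar> \<le> 1/2 \<Longrightarrow> \<eta> x = 1 + x"
    "\<And>x. \<bar>x\<bar> \<ge> 1 \<Longrightarrow> \<eta> x = 0"
    by (rule smooth_linear_bump_exists) blast
  have "summable (\<lambda>m. (1 + (\<phi> (x m))\<^sup>2) ^ n * \<bar>a m\<bar>)" for n
  proof (rule summable_comparison_test')
    show "summable (\<lambda>m. (1 + c\<^sup>2) ^ n * (q m ^ (2 * p * n) * inverse (q m ^ m)))"
      by (intro summable_mult summable_power_mult_inverse_power q(1))
    show "norm ((1 + (\<phi> (x m))\<^sup>2) ^ n * \<bar>a m\<bar>) \<le> (1 + c\<^sup>2) ^ n * (q m ^ (2 * p * n) * inverse (q m ^ m))"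
      if "m \<ge> 0" for m
    proof -
      have "(1 + (\<phi> (x m))\<^sup>2) ^ n * a m \<le> ((1 + c\<^sup>2) * q m ^ (2 * p)) ^ n * a m"
        using a_pos[of m] by (intro mult_right_mono power_mono phi_sq) auto
      also have "\<dots> = (1 + c\<^sup>2) ^ n * (q m ^ (2 * p * n) * a m)"
        by (simp only: power_mult_distrib power_mult[symmetric] mult.assoc)
      finally show ?thesis
        using a_pos[of m] by (simp add: a_def)
    qed
  qed
  then interpret bump_series \<eta> "\<lambda>m. \<phi> (x m)" a
    using \<eta> x(2) by (intro bump_series.intro) auto
  have "bump_limit \<circ> \<phi> \<in> schwartz"
    using symbol bump_limit_schwartz by (simp add: schwartz_symbol_def)
  then obtain d where d: "\<And>z. (1 + z\<^sup>2) ^ 1 * \<bar>(deriv ^^ j) (bump_limit \<circ> \<phi>) z\<bar> \<le> d"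
    by (rule schwartzD) blast
  have "real m < d" for m
  proof -
    let ?g = "\<lambda>z. a m * \<phi> z + a m * (1 - \<phi> (x m))"
    have "open {z. \<bar>\<phi> z - \<phi> (x m)\<bar> < 1/2}"
      by (intro open_Collect_less continuous_intros continuous_at_imp_continuous_on ballI
          smooth_isCont smooth)
    then have "(deriv ^^ j) (bump_limit \<circ> \<phi>) (x m) = (deriv ^^ j) ?g (x m)"
      by (rule higher_deriv_cong_open) (auto simp: bump_limit_near_centre algebra_simps)
    \<comment> \<open>The constant part of the affine expression disappears because j > 0.\<close>
    also have "\<dots> = a m * ?D (x m)"
      using \<open>j > 0\<close> smooth
      by (simp add: higher_deriv_add_smooth higher_deriv_cmult_smooth higher_deriv_const_real
          smooth_mult)
    finally have "q m * (a m * \<bar>?D (x m)\<bar>) \<le> d"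
      using d[of "x m"] a_pos[of m] by (simp add: q_def abs_mult)
    moreover have "q m * 1 < q m * (a m * \<bar>?D (x m)\<bar>)"
    proof (rule mult_strict_left_mono)
      have "a m * q m ^ m < a m * \<bar>?D (x m)\<bar>"
        using x(1)[of m] a_pos[of m] by (intro mult_strict_left_mono) (auto simp: q_def)
      then show "1 < a m * \<bar>?D (x m)\<bar>"
        using q(2)[of m] by (simp add: a_def)
    qed (rule q(2))
    ultimately show ?thesis
      using q_ge[of m] by linarith
  qed
  then show False
    by (meson less_asym reals_Archimedean2)
qed

section \<open>Multiplier property of the symbol and lower bound for its derivative\<close>

theorem theorem4p10:
  fixes \<phi> :: "real \<Rightarrow> real"
  assumes "schwartz_symbol \<phi>"
    and "surj \<phi>"
    and "schwartz_closed_range (comp_op \<phi>)"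
    and "\<exists>k::real. \<forall>x. \<bar>x\<bar> > k \<longrightarrow> deriv \<phi> x \<noteq> 0"
  shows "\<phi> \<in> O_M \<and>
    (\<exists>c T :: real. c > 0 \<and> T > 0 \<and>
      (\<forall>\<^sub>F x in at_infinity. \<bar>deriv \<phi> x\<bar> \<ge> c * (1 + x^2) powr (- T)))"
proof -
  have smooth: "smooth \<phi>"
    using assms(1) by (simp add: schwartz_symbol_def)
  obtain k where k: "\<And>x. \<bar>x\<bar> > k \<Longrightarrow> deriv \<phi> x \<noteq> 0"
    using assms(4) by blast
  obtain K where K: "K > 0" "K > k" "\<And>x z. \<bar>x\<bar> > K \<Longrightarrow> \<phi> z = \<phi> x \<Longrightarrow> z = x"
    using unique_preimage_near_infinity[OF smooth_has_deriv[OF smooth] k assms(2)] by blast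
  interpret injective_near_infinity \<phi> K
  proof
    show "deriv \<phi> x \<noteq> 0" if "\<bar>x\<bar> > K" for x
      by (rule k) (use that K(2) in linarith)
  qed (use smooth assms(2) K in blast)+
  obtain p N where pN: "\<And>x. \<bar>x\<bar> > N \<Longrightarrow> 1 + (\<phi> x)\<^sup>2 + 1 / \<bar>deriv \<phi> x\<bar> \<le> (1 + x\<^sup>2) ^ p"
    using growth_bound[OF assms(3)] by blast
  obtain b where b: "\<And>x. \<bar>x\<bar> \<le> N \<Longrightarrow> \<bar>\<phi> x\<bar> \<le> b"
    using bounded_on_interval[OF smooth] by blast
  have "\<bar>\<phi> x\<bar> \<le> max b 1 * (1 + x\<^sup>2) ^ p" for x
  proof (cases "\<bar>x\<bar> \<le> N")
    case True
    have "(1 + x\<^sup>2) ^ p \<ge> 1"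
      by (intro one_le_power) simp
    then have "max b 1 * 1 \<le> max b 1 * (1 + x\<^sup>2) ^ p"
      by (intro mult_left_mono) auto
    then show ?thesis
      using b[OF True] by linarith
  next
    case False
    have "\<bar>\<phi> x\<bar> \<le> 1 + (\<phi> x)\<^sup>2"
      using sum_squares_bound[of "\<bar>\<phi> x\<bar>" 1] by simp
    also have "\<dots> \<le> 1 + (\<phi> x)\<^sup>2 + 1 / \<bar>deriv \<phi> x\<bar>"
      by simp
    also have "\<dots> \<le> 1 * (1 + x\<^sup>2) ^ p"
      using pN[of x] False by simp
    also have "\<dots> \<le> max b 1 * (1 + x\<^sup>2) ^ p"
      by (intro mult_right_mono) auto
    finally show ?thesis .
  qed
  then have "poly_bounded \<phi>"
    unfolding poly_bounded_def by blast
  then have "\<phi> \<in> O_M"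
    unfolding O_M_def using smooth assms(1)
    by (auto intro: mult_poly_bounded_schwartz higher_deriv_symbol_poly_bounded)
  \<comment> \<open>The exponent is raised by one because T has to be positive while
    \<open>p\<close> may be 0.\<close>
  moreover have "\<forall>\<^sub>F x in at_infinity. \<bar>deriv \<phi> x\<bar> \<ge> 1 * (1 + x\<^sup>2) powr (- (real p + 1))"
    unfolding eventually_at_infinity
  proof (intro exI allI impI)
    fix x :: real assume "max N K + 1 \<le> norm x"
    then have x: "\<bar>x\<bar> > N" "\<bar>x\<bar> > K"
      by auto
    have "1 / \<bar>deriv \<phi> x\<bar> \<le> (1 + x\<^sup>2) ^ p"
      using pN[OF x(1)] by (smt (verit) zero_le_power2)
    \<comment> \<open>Since 1 / 0 = 0, the preceding bound says nothing at a zero of \<phi>'; the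
      choice |x| > K rules such points out before inverting.\<close>
    then have "inverse ((1 + x\<^sup>2) ^ p) \<le> inverse (1 / \<bar>deriv \<phi> x\<bar>)"
      using deriv_nonzero[OF x(2)] by (intro le_imp_inverse_le) auto
    moreover have "(1 + x\<^sup>2) powr (- (real p + 1)) \<le> (1 + x\<^sup>2) powr (- real p)"
      by (intro powr_mono) auto
    moreover have "(1 + x\<^sup>2) powr (- real p) = inverse ((1 + x\<^sup>2) ^ p)"
      by (simp add: powr_minus powr_realpow add_pos_nonneg)
    ultimately show "1 * (1 + x\<^sup>2) powr (- (real p + 1)) \<le> \<bar>deriv \<phi> x\<bar>"
      by simp
  qed
  ultimately show ?thesis
    by (intro conjI exI[of _ 1] exI[of _ "real p + 1"]) auto
qed

end
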